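(* Let $\mathcal C$ be a finite groupoid and $\rho,\sigma\in\mathrm{wr}(\mathcal C)$. Then $\rho$ and $\sigma$ are conjugate in $\mathrm{wr}(\mathcal C)$ if and only if $c(\rho)=c(\sigma)$. If these equivalent conditions hold, the number of $\alpha\in\mathrm{wr}(\mathcal C)$ with $\alpha\rho=\sigma\alpha$ equals $$\prod_{k\ge1,\ [\gamma]\in\digamma(\mathcal C)}\Big(c(\rho,k,[\gamma])!\cdot\big(k\cdot\#C_{\mathcal C}(\gamma)\big)^{c(\rho,k,[\gamma])}\Big).$$ Moreover, if $\mathcal D$ is a wide subgroupoid of $\mathcal C$, the number of $\alpha\in\mathrm{wr}(\mathcal D)$ with $\alpha\rho=\sigma\alpha$ is at most $(\#\mathrm{aut}(\mathcal D))^{N}$, where $N$ is the number of orbits of $\langle r\rangle$ on $\mathrm{obj}(\mathcal C)$ (with $\rho=((\rho_K)_K,r)$).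
   Context: The wreath $\mathrm{wr}(\mathcal C)$ of a finite groupoid $\mathcal C$ is the group of pairs $\sigma=((\sigma_K)_{K\in\mathrm{obj}(\mathcal C)},s)$ with $s$ a permutation of $\mathrm{obj}(\mathcal C)$ and $\sigma_K\in\mathrm{Hom}_{\mathcal C}(K,s(K))$, with composition $((\sigma_K)_K,s)\circ((\rho_K)_K,r)=((\sigma_{r(K)}\circ\rho_K)_K,s\circ r)$. $\mathrm{wr}(\mathcal D)\subseteq\mathrm{wr}(\mathcal C)$ for a wide subgroupoid $\mathcal D$ (same objects). $\mathrm{aut}(\mathcal D)$ is the set of all automorphisms of all objects of $\mathcal D$. For $K\in\mathrm{obj}$ with $\langle s\rangle$-orbit of length $n$, $\lambda_\sigma(K)=\sigma_{s^{n-1}(K)}\circ\cdots\circ\sigma_{s(K)}\circ\sigma_K\in\mathrm{Aut}_{\mathcal C}(K)$. Two automorphisms $\alpha\in\mathrm{Aut}(K)$, $\beta\in\mathrm{Aut}(L)$ are $\mathcal C$-conjugate if $\omega\alpha=\beta\omega$ for some $\omega\in\mathrm{Hom}_{\mathcal C}(K,L)$; $\digamma(\mathcal C)$ is the set of classes of this equivalence relation on $\mathrm{aut}(\mathcal C)$. The label of an orbit $O$ of $\langle s\rangle$ is the class of $\lambda_\sigma(K)$ for any $K\in O$ (independent of $K$). $c(\sigma,k,[\gamma])$ is the number of $\langle s\rangle$-orbits of length $k$ with label $[\gamma]$, and $c(\sigma)=(c(\sigma,k,[\gamma]))_{k,[\gamma]}$. For $\gamma\in\mathrm{Aut}_{\mathcal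 C}(K)$, $C_{\mathcal C}(\gamma)$ is its centralizer in $\mathrm{Aut}_{\mathcal C}(K)$ (its size depends only on $[\gamma]$). *)

theory Defs
  imports "HOL-Algebra.Group" "HOL-Combinatorics.Permutations"
begin

text \<open>A (small) category given by objects, morphisms, domain, codomain,
  composition (gcomp g f = g after f) and identities.\<close>
record ('o, 'm) groupoid =
  Obj   :: "'o set"
  Mor   :: "'m set"
  gdom  :: "'m \<Rightarrow> 'o"
  gcod  :: "'m \<Rightarrow> 'o"
  gcomp :: "'m \<Rightarrow> 'm \<Rightarrow> 'm"
  gid   :: "'o \<Rightarrow> 'm"

definition Hom :: "('o, 'm) groupoid \<Rightarrow> 'o \<Rightarrow> 'o \<Rightarrow> 'm set" where
  "Hom C K L = {f \<in> Mor C. gdom C f = K \<and> gcod C f = L}"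

definition is_groupoid :: "('o, 'm) groupoid \<Rightarrow> bool" where
  "is_groupoid C \<longleftrightarrow>
     (\<forall>f\<in>Mor C. gdom C f \<in> Obj C \<and> gcod C f \<in> Obj C) \<and>
     (\<forall>K\<in>Obj C. gid C K \<in> Hom C K K) \<and>
     (\<forall>f\<in>Mor C. \<forall>g\<in>Mor C. gcod C f = gdom C g \<longrightarrow>
         gcomp C g f \<in> Hom C (gdom C f) (gcod C g)) \<and>
     (\<forall>f\<in>Mor C. \<forall>g\<in>Mor C. \<forall>h\<in>Mor C. gcod C f = gdom C g \<longrightarrow> gcod C g = gdom C h \<longrightarrow>
         gcomp C h (gcomp C g f) = gcomp C (gcomp C h g) f) \<and>
     (\<forall>f\<in>Mor C. gcomp C (gid C (gcod C f)) f = f \<and> gcomp C f (gid C (gdom C f)) = f) \<and>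
     (\<forall>f\<in>Mor C. \<exists>g\<in>Hom C (gcod C f) (gdom C f).
         gcomp C g f = gid C (gdom C f) \<and> gcomp C f g = gid C (gcod C f))"

definition finite_groupoid :: "('o, 'm) groupoid \<Rightarrow> bool" where
  "finite_groupoid C \<longleftrightarrow> is_groupoid C \<and> finite (Obj C) \<and> finite (Mor C)"

definition wide_subgroupoid :: "('o, 'm) groupoid \<Rightarrow> ('o, 'm) groupoid \<Rightarrow> bool" where
  "wide_subgroupoid D C \<longleftrightarrow> is_groupoid D \<and> Obj D = Obj C \<and> Mor D \<subseteq> Mor C \<and>
     (\<forall>f\<in>Mor D. gdom D f = gdom C f \<and> gcod D f = gcod C f) \<and>
     (\<forall>f\<in>Mor D. \<forall>g\<in>Mor D. gcod D f = gdom D g \<longrightarrow> gcomp D g f = gcomp C g f) \<and>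
     (\<forall>K\<in>Obj D. gid D K = gid C K)"

definition aut :: "('o, 'm) groupoid \<Rightarrow> 'm set" where
  "aut C = {f \<in> Mor C. gdom C f = gcod C f}"

definition Aut :: "('o, 'm) groupoid \<Rightarrow> 'o \<Rightarrow> 'm set" where
  "Aut C K = Hom C K K"

text \<open>Elements are pairs (family of morphisms, permutation of objects);
  the family is extensional (undefined outside the objects).\<close>
type_synonym ('o, 'm) wr_elem = "('o \<Rightarrow> 'm) \<times> ('o \<Rightarrow> 'o)"

definition wr :: "('o, 'm) groupoid \<Rightarrow> ('o, 'm) wr_elem set" where
  "wr C = {(f, s). s permutes Obj C \<and> (\<forall>K\<in>Obj C. f K \<in> Hom C K (s K)) \<and>
                   (\<forall>K. K \<notin> Obj C \<longrightarrow> f K = undefined)}"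

definition wr_mult :: "('o, 'm) groupoid \<Rightarrow> ('o, 'm) wr_elem \<Rightarrow> ('o, 'm) wr_elem \<Rightarrow> ('o, 'm) wr_elem" where
  "wr_mult C \<sigma> \<rho> =
     ((\<lambda>K. if K \<in> Obj C then gcomp C (fst \<sigma> (snd \<rho> K)) (fst \<rho> K) else undefined),
      snd \<sigma> \<circ> snd \<rho>)"

definition wr_one :: "('o, 'm) groupoid \<Rightarrow> ('o, 'm) wr_elem" where
  "wr_one C = ((\<lambda>K. if K \<in> Obj C then gid C K else undefined), id)"

definition wr_group :: "('o, 'm) groupoid \<Rightarrow> ('o, 'm) wr_elem monoid" where
  "wr_group C = \<lparr>carrier = wr C, monoid.mult = wr_mult C, one = wr_one C\<rparr>"

definition wr_conjugate :: "('o, 'm) groupoid \<Rightarrow> ('o, 'm) wr_elem \<Rightarrow> ('o, 'm) wr_elem \<Rightarrow> bool" where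
  "wr_conjugate C \<rho> \<sigma> \<longleftrightarrow>
     (\<exists>\<alpha>\<in>carrier (wr_group C). \<alpha> \<otimes>\<^bsub>wr_group C\<^esub> \<rho> \<otimes>\<^bsub>wr_group C\<^esub> inv\<^bsub>wr_group C\<^esub> \<alpha> = \<sigma>)"

definition orb :: "('o \<Rightarrow> 'o) \<Rightarrow> 'o \<Rightarrow> 'o set" where
  "orb s K = {(s ^^ n) K | n. True}"

definition orbit_len :: "('o \<Rightarrow> 'o) \<Rightarrow> 'o \<Rightarrow> nat" where
  "orbit_len s K = (LEAST n. n > 0 \<and> (s ^^ n) K = K)"

fun lam_iter :: "('o, 'm) groupoid \<Rightarrow> ('o, 'm) wr_elem \<Rightarrow> 'o \<Rightarrow> nat \<Rightarrow> 'm" where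
  "lam_iter C \<sigma> K 0 = gid C K"
| "lam_iter C \<sigma> K (Suc n) = gcomp C (fst \<sigma> ((snd \<sigma> ^^ n) K)) (lam_iter C \<sigma> K n)"

definition lam :: "('o, 'm) groupoid \<Rightarrow> ('o, 'm) wr_elem \<Rightarrow> 'o \<Rightarrow> 'm" where
  "lam C \<sigma> K = lam_iter C \<sigma> K (orbit_len (snd \<sigma>) K)"

definition gconj :: "('o, 'm) groupoid \<Rightarrow> 'm \<Rightarrow> 'm \<Rightarrow> bool" where
  "gconj C \<alpha> \<beta> \<longleftrightarrow> \<alpha> \<in> aut C \<and> \<beta> \<in> aut C \<and>
     (\<exists>\<omega>\<in>Hom C (gdom C \<alpha>) (gdom C \<beta>). gcomp C \<omega> \<alpha> = gcomp C \<beta> \<omega>)"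

definition conj_class :: "('o, 'm) groupoid \<Rightarrow> 'm \<Rightarrow> 'm set" where
  "conj_class C \<gamma> = {\<beta>. gconj C \<gamma> \<beta>}"

definition digamma :: "('o, 'm) groupoid \<Rightarrow> 'm set set" where
  "digamma C = conj_class C ` aut C"

definition label :: "('o, 'm) groupoid \<Rightarrow> ('o, 'm) wr_elem \<Rightarrow> 'o \<Rightarrow> 'm set" where
  "label C \<sigma> K = conj_class C (lam C \<sigma> K)"

definition cyc :: "('o, 'm) groupoid \<Rightarrow> ('o, 'm) wr_elem \<Rightarrow> nat \<Rightarrow> 'm set \<Rightarrow> nat" where
  "cyc C \<sigma> k X = card {orb (snd \<sigma>) K | K. K \<in> Obj C \<and> orbit_len (snd \<sigma>) K = k \<and> label C \<sigma> K = X}"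

definition centralizer :: "('o, 'm) groupoid \<Rightarrow> 'm \<Rightarrow> 'm set" where
  "centralizer C \<gamma> = {\<delta> \<in> Aut C (gdom C \<gamma>). gcomp C \<delta> \<gamma> = gcomp C \<gamma> \<delta>}"

text \<open>Size of the centralizer of any representative of a class.\<close>
definition cent_card :: "('o, 'm) groupoid \<Rightarrow> 'm set \<Rightarrow> nat" where
  "cent_card C X = card (centralizer C (SOME \<gamma>. \<gamma> \<in> X))"

definition num_orbits :: "('o, 'm) groupoid \<Rightarrow> ('o \<Rightarrow> 'o) \<Rightarrow> nat" where
  "num_orbits C r = card {orb r K | K. K \<in> Obj C}"

end

theory Submission
  imports Defs
begin

text \<open>An \<open>\<alpha>\<close> with \<open>\<alpha> \<rho> = \<sigma> \<alpha>\<close> is determined by its components at a set \<open>R\<close> of orbit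
  representatives of \<open>\<rho>\<close>. A family \<open>(f\<^sub>K)\<close> indexed by \<open>K \<in> R\<close> arises in this way iff each
  \<open>f\<^sub>K : K \<rightarrow> L\<close> carries the orbit of \<open>K\<close> to one of equal length and intertwines \<open>\<lambda>\<^sub>\<rho>(K)\<close> with
  \<open>\<lambda>\<^sub>\<sigma>(L)\<close>, and distinct representatives reach distinct \<open>\<sigma>\<close>-orbits. For each \<open>\<sigma>\<close>-orbit of the same
  length \<open>k\<close> and label as \<open>K\<close> there are \<open>k\<close> choices of \<open>L\<close> and as many intertwiners as the size of
  the centralizer. Hence, with \<open>a = c(\<rho>,k,X)\<close> and \<open>b = c(\<sigma>,k,X)\<close>, the number of such \<open>\<alpha>\<close> is always the
  product over all \<open>(k,X)\<close> of \<open>b (b - 1) \<cdots> (b - a + 1) (k #C)\<^sup>a\<close>. It is nonzero iff \<open>a \<le> b\<close> for all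
  \<open>(k,X)\<close>, and conjugacy is symmetric.\<close>

section \<open>Orbits of a permutation of a finite set\<close>

lemma orbit_len_props:
  assumes "finite A" "s permutes A"
  shows "orbit_len s K > 0" and "(s ^^ orbit_len s K) K = K"
proof -
  have "permutation s" using assms by (auto simp: permutation_permutes)
  then have "\<exists>n. n > 0 \<and> (s ^^ n) K = K"
    by (rule permutation_self[of s K]) blast
  from LeastI_ex[OF this] show "orbit_len s K > 0" "(s ^^ orbit_len s K) K = K"
    unfolding orbit_len_def by auto
qed

lemma funpow_fixed_mult:
  assumes "(s ^^ m) K = K"
  shows "(s ^^ (m * q)) K = K"
  by (induction q) (auto simp: funpow_add assms)

text \<open>Division with remainder: the remainder of a period \<open>n\<close> modulo the orbit
  length is again a period, and if positive it would contradict minimality.\<close>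

lemma orbit_len_dvd_iff:
  assumes "finite A" "s permutes A"
  shows "(s ^^ n) K = K \<longleftrightarrow> orbit_len s K dvd n"
proof
  let ?k = "orbit_len s K"
  assume n: "(s ^^ n) K = K"
  have "(s ^^ n) K = (s ^^ (n mod ?k)) ((s ^^ (?k * (n div ?k))) K)"
    by (metis comp_apply funpow_add mod_mult_div_eq)
  then have m: "(s ^^ (n mod ?k)) K = K"
    using funpow_fixed_mult[OF orbit_len_props(2)[OF assms]] n by metis
  show "?k dvd n"
  proof (rule ccontr)
    assume "\<not> ?k dvd n"
    then have "n mod ?k > 0" by (auto simp: dvd_eq_mod_eq_0)
    then have "?k \<le> n mod ?k"
      unfolding orbit_len_def by (rule_tac Least_le) (use m orbit_len_def in metis)
    then show False
      using mod_less_divisor[OF orbit_len_props(1)[OF assms, of K], of n] by linarith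
  qed
next
  assume "orbit_len s K dvd n"
  then show "(s ^^ n) K = K"
    using funpow_fixed_mult[OF orbit_len_props(2)[OF assms]] by auto
qed

lemma funpow_eq_iff_orbit_len:
  assumes "finite A" "s permutes A" "n \<le> m"
  shows "(s ^^ n) K = (s ^^ m) K \<longleftrightarrow> orbit_len s K dvd m - n"
proof -
  have "(s ^^ m) K = (s ^^ n) ((s ^^ (m - n)) K)"
    using assms(3) by (metis comp_apply funpow_add le_add_diff_inverse)
  moreover have "inj (s ^^ n)" using assms(2) by (simp add: inj_fn permutes_inj)
  ultimately show ?thesis
    using orbit_len_dvd_iff[OF assms(1,2), of "m - n" K] by (metis injD)
qed

text \<open>Two distinct exponents below the orbit length differ by less than that length, hence not
  by a multiple of it.\<close>

lemma inj_on_funpow_orbit: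
  assumes "finite A" "s permutes A"
  shows "inj_on (\<lambda>n. (s ^^ n) K) {..<orbit_len s K}"
proof (rule linorder_inj_onI)
  fix n m :: nat assume "n < m" "n \<in> {..<orbit_len s K}" "m \<in> {..<orbit_len s K}"
  then show "(s ^^ n) K \<noteq> (s ^^ m) K"
    using funpow_eq_iff_orbit_len[OF assms, of n m K] nat_dvd_not_less[of "m - n" "orbit_len s K"]
    by auto
qed auto

lemma funpow_mod_orbit_len:
  assumes "finite A" "s permutes A"
  shows "(s ^^ (n mod orbit_len s K)) K = (s ^^ n) K"
  using funpow_eq_iff_orbit_len[OF assms, of "n mod orbit_len s K" n K]
  by (simp add: dvd_minus_mod)

lemma orb_eq_image:
  assumes "finite A" "s permutes A"
  shows "orb s K = (\<lambda>n. (s ^^ n) K) ` {..<orbit_len s K}"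
proof -
  have "(s ^^ n) K \<in> (\<lambda>n. (s ^^ n) K) ` {..<orbit_len s K}" for n
    using funpow_mod_orbit_len[OF assms, of n K] orbit_len_props(1)[OF assms, of K]
    by (metis imageI lessThan_iff mod_less_divisor)
  then show ?thesis by (auto simp: orb_def)
qed

lemma card_orb:
  assumes "finite A" "s permutes A"
  shows "card (orb s K) = orbit_len s K"
  by (simp add: orb_eq_image[OF assms] card_image[OF inj_on_funpow_orbit[OF assms]])

lemma finite_orb: "finite A \<Longrightarrow> s permutes A \<Longrightarrow> finite (orb s K)"
  by (simp add: orb_eq_image)

lemma orb_subset:
  assumes "s permutes A" "K \<in> A"
  shows "orb s K \<subseteq> A"
  using permutes_in_funpow_image[OF assms] by (auto simp: orb_def)

lemma orb_self: "K \<in> orb s K"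
  unfolding orb_def by (auto intro: exI[of _ 0])

lemma orb_eq_of_mem:
  assumes "finite A" "s permutes A" "L \<in> orb s K"
  shows "orb s L = orb s K"
proof
  from assms(3) obtain n where L: "L = (s ^^ n) K" by (auto simp: orb_def)
  show "orb s L \<subseteq> orb s K"
    unfolding L orb_def by (force simp: funpow_add[symmetric, THEN fun_cong, simplified])
  let ?k = "orbit_len s K"
  \<comment> \<open>\<open>orb\<close> collects only nonnegative powers of \<open>s\<close>, so the
    way back from \<open>L\<close> to \<open>K\<close> goes forward: \<open>n\<close> steps followed
    by \<open>n * (?k - 1)\<close> more add up to a multiple of the orbit length.\<close>
  have "K = (s ^^ (n * (?k - 1))) L"
  proof -
    have "(s ^^ (n * (?k - 1))) L = (s ^^ (n * (?k - 1) + n)) K"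
      by (simp add: L funpow_add)
    also have "n * (?k - 1) + n = ?k * n"
      using orbit_len_props(1)[OF assms(1,2), of K] by (cases ?k) auto
    finally show ?thesis using funpow_fixed_mult[OF orbit_len_props(2)[OF assms(1,2)]] by metis
  qed
  then obtain m where K: "K = (s ^^ m) L" by blast
  show "orb s K \<subseteq> orb s L"
    unfolding orb_def by (subst K) (force simp: funpow_add[symmetric, THEN fun_cong, simplified])
qed

lemma orbit_len_le:
  assumes "finite A" "s permutes A" "K \<in> A"
  shows "orbit_len s K \<le> card A"
  using card_mono[OF assms(1) orb_subset[OF assms(2,3)]] card_orb[OF assms(1,2)] by simp

section \<open>Counting choices that are injective on classes\<close>

lemma card_UN_fibres:
  assumes "finite B" "\<And>x. x \<in> A \<Longrightarrow> q x \<in> B" "\<And>b. b \<in> B \<Longrightarrow> card {x \<in> A. q x = b} = w"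
    and "finite A"
  shows "card A = card B * w"
proof -
  have "A = (\<Union>b\<in>B. {x \<in> A. q x = b})" using assms(2) by auto
  then have "card A = (\<Sum>b\<in>B. card {x \<in> A. q x = b})"
    using assms(1,4) by (subst \<open>A = _\<close>, intro card_UN_disjoint) auto
  then show ?thesis using assms(3) by simp
qed

text \<open>Induction on \<open>R\<close>. Once choices on \<open>R\<close> are made, a new
  \<open>x\<close> must avoid the classes of \<open>S (t x)\<close> already taken, and by
  disjointness only indices of the same type as \<open>x\<close> take any of them. Each class left
  offers \<open>w (t x)\<close> choices. Subtraction is truncated: if a type has more indices than
  classes, some factor is 0, in agreement with the absence of injective choices.\<close>

lemma card_injective_choices:
  fixes M :: "'a \<Rightarrow> 'm set" and q :: "'m \<Rightarrow> 'c" and t :: "'a \<Rightarrow> 't" and S :: "'t \<Rightarrow> 'c set"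
  assumes "finite R" and "finite T" and "t ` R \<subseteq> T"
    and finM: "\<And>x. x \<in> R \<Longrightarrow> finite (M x)"
    and finS: "\<And>u. u \<in> T \<Longrightarrow> finite (S u)"
    and disj: "\<And>u v. u \<in> T \<Longrightarrow> v \<in> T \<Longrightarrow> u \<noteq> v \<Longrightarrow> S u \<inter> S v = {}"
    and q: "\<And>x f. x \<in> R \<Longrightarrow> f \<in> M x \<Longrightarrow> q f \<in> S (t x)"
    and fib: "\<And>x c. x \<in> R \<Longrightarrow> c \<in> S (t x) \<Longrightarrow> card {f \<in> M x. q f = c} = w (t x)"
  shows "card {g \<in> PiE R M. inj_on (\<lambda>x. q (g x)) R} =
    (\<Prod>u\<in>T. (\<Prod>i<card {x \<in> R. t x = u}. card (S u) - i) * w u ^ card {x \<in> R. t x = u})"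
  using assms(1,3) finM q fib
proof (induction R rule: finite_induct)
  case empty
  have "{g. g = (\<lambda>x. undefined)} = {(\<lambda>x. undefined) :: 'a \<Rightarrow> 'm}" by auto
  then show ?case by (simp add: PiE_empty_domain)
next
  case (insert x R)
  let ?G = "\<lambda>R. {g \<in> PiE R M. inj_on (\<lambda>x. q (g x)) R}"
  let ?n = "\<lambda>R u. card {x \<in> R. t x = u}"
  let ?F = "\<lambda>R u. (\<Prod>i<?n R u. card (S u) - i) * w u ^ ?n R u"
  let ?N = "\<lambda>g. {f \<in> M x. q f \<notin> (\<lambda>y. q (g y)) ` R}"
  have tx: "t x \<in> T" and tR: "t ` R \<subseteq> T" using insert.prems(1) by auto
  have finN: "finite (?N g)" for g using insert.prems(2)[of x] by auto
  have cardN: "card (?N g) = (card (S (t x)) - ?n R (t x)) * w (t x)" if g: "g \<in> ?G R" for g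
  proof -
    let ?Y = "{y \<in> R. t y = t x}"
    have qg: "q (g y) \<in> S (t y)" if "y \<in> R" for y
      using g that insert.prems(3)[of y "g y"] by (auto simp: PiE_def Pi_def)
    have int: "S (t x) \<inter> (\<lambda>y. q (g y)) ` R = (\<lambda>y. q (g y)) ` ?Y"
    proof (intro equalityI subsetI)
      fix c assume "c \<in> S (t x) \<inter> (\<lambda>y. q (g y)) ` R"
      then obtain y where y: "y \<in> R" "c = q (g y)" "c \<in> S (t x)" by auto
      have "t y = t x"
        using disj[of "t y" "t x"] qg[OF y(1)] y tx tR by blast
      then show "c \<in> (\<lambda>y. q (g y)) ` ?Y" using y by auto
    next
      fix c assume "c \<in> (\<lambda>y. q (g y)) ` ?Y"
      then obtain y where "y \<in> R" "t y = t x" "c = q (g y)" by auto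
      then show "c \<in> S (t x) \<inter> (\<lambda>y. q (g y)) ` R" using qg[of y] by auto
    qed
    have "card (?N g) = card (S (t x) - (\<lambda>y. q (g y)) ` R) * w (t x)"
    proof (rule card_UN_fibres[where q = q])
      fix c assume c: "c \<in> S (t x) - (\<lambda>y. q (g y)) ` R"
      then have "{f \<in> ?N g. q f = c} = {f \<in> M x. q f = c}" by auto
      then show "card {f \<in> ?N g. q f = c} = w (t x)" using insert.prems(4)[of x c] c by auto
    qed (use finS tx insert.prems(3) finN in auto)
    also have "card (S (t x) - (\<lambda>y. q (g y)) ` R) = card (S (t x)) - card ((\<lambda>y. q (g y)) ` ?Y)"
      using card_Diff_subset_Int[of "S (t x)" "(\<lambda>y. q (g y)) ` R"] insert.hyps(1) by (simp add: int)
    also have "card ((\<lambda>y. q (g y)) ` ?Y) = card ?Y"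
      using g by (intro card_image) (auto intro: inj_on_subset)
    finally show ?thesis .
  qed
  \<comment> \<open>A choice on \<open>insert x R\<close> amounts to a choice on \<open>R\<close>
    together with a value at \<open>x\<close> whose class is new.\<close>
  have "bij_betw (\<lambda>(g, f). g(x := f)) (SIGMA g:?G R. ?N g) (?G (insert x R))"
  proof (rule bij_betwI[where g = "\<lambda>g. (restrict g R, g x)"])
    show "(\<lambda>(g, f). g(x := f)) \<in> (SIGMA g:?G R. ?N g) \<rightarrow> ?G (insert x R)"
    proof (intro funcsetI, clarify)
      fix g f assume g: "g \<in> PiE R M" "inj_on (\<lambda>x. q (g x)) R" and f: "f \<in> M x" "q f \<notin> (\<lambda>y. q (g y)) ` R"
      have "g(x := f) \<in> PiE (insert x R) M" using g f by (simp add: PiE_fun_upd)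
      moreover have "inj_on (\<lambda>y. q ((g(x := f)) y)) R"
        using g insert.hyps(2) by (subst inj_on_cong[where g = "\<lambda>y. q (g y)"]) auto
      moreover have "(\<lambda>y. q ((g(x := f)) y)) ` R = (\<lambda>y. q (g y)) ` R"
        using insert.hyps(2) by (intro image_cong) auto
      ultimately show "g(x := f) \<in> PiE (insert x R) M \<and> inj_on (\<lambda>y. q ((g(x := f)) y)) (insert x R)"
        using f insert.hyps(2) by (simp only: inj_on_insert) simp
    qed
    show "(\<lambda>g. (restrict g R, g x)) \<in> ?G (insert x R) \<rightarrow> (SIGMA g:?G R. ?N g)"
    proof
      fix g assume g: "g \<in> ?G (insert x R)"
      then have "inj_on (\<lambda>y. q (restrict g R y)) R"
        by (subst inj_on_cong[where g = "\<lambda>y. q (g y)"]) (auto intro: inj_on_subset)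
      moreover have "q (g x) \<notin> (\<lambda>y. q (restrict g R y)) ` R"
        using g insert.hyps(2) by auto
      ultimately show "(restrict g R, g x) \<in> (SIGMA g:?G R. ?N g)"
        using g by auto
    qed
    show "(\<lambda>g. (restrict g R, g x)) ((\<lambda>(g, f). g(x := f)) y) = y"
      if "y \<in> (SIGMA g:?G R. ?N g)" for y
      using that insert.hyps(2) by (auto simp: PiE_def extensional_def restrict_def fun_eq_iff)
    show "(\<lambda>(g, f). g(x := f)) (restrict g R, g x) = g" if "g \<in> ?G (insert x R)" for g
      using that by (auto simp: PiE_def extensional_def restrict_def fun_eq_iff)
  qed
  then have "card (?G (insert x R)) = card (SIGMA g:?G R. ?N g)" by (simp add: bij_betw_same_card)
  also have "\<dots> = (\<Sum>g\<in>?G R. card (?N g))"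
  proof (rule card_SigmaI)
    show "finite (?G R)"
      using insert.hyps(1) insert.prems(2) by (auto intro!: finite_subset[OF _ finite_PiE[of R M]])
  qed (use finN in auto)
  also have "\<dots> = card (?G R) * ((card (S (t x)) - ?n R (t x)) * w (t x))"
    by (subst sum.cong[OF refl cardN]) auto
  also have "card (?G R) = (\<Prod>u\<in>T. ?F R u)"
    using tR insert.prems by (intro insert.IH) auto
  \<comment> \<open>Only the factor belonging to the type of \<open>x\<close> changes: its product
    is extended by one index and its power of \<open>w (t x)\<close> by one.\<close>
  also have "\<dots> = ?F R (t x) * (\<Prod>u\<in>T - {t x}. ?F R u)"
    using assms(2) tx by (rule prod.remove)
  also have "(\<Prod>u\<in>T - {t x}. ?F R u) = (\<Prod>u\<in>T - {t x}. ?F (insert x R) u)"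
  proof (rule prod.cong)
    fix u assume "u \<in> T - {t x}"
    then have "{y \<in> insert x R. t y = u} = {y \<in> R. t y = u}" by auto
    then show "?F R u = ?F (insert x R) u" by simp
  qed auto
  also have "?F R (t x) * (\<Prod>u\<in>T - {t x}. ?F (insert x R) u) *
      ((card (S (t x)) - ?n R (t x)) * w (t x)) =
    ?F (insert x R) (t x) * (\<Prod>u\<in>T - {t x}. ?F (insert x R) u)"
  proof -
    have "{y \<in> insert x R. t y = t x} = insert x {y \<in> R. t y = t x}" by auto
    then have "?n (insert x R) (t x) = Suc (?n R (t x))"
      using insert.hyps by simp
    then show ?thesis by (simp add: algebra_simps)
  qed
  also have "\<dots> = (\<Prod>u\<in>T. ?F (insert x R) u)"
    using assms(2) tx by (rule prod.remove[symmetric])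
  finally show ?case .
qed

section \<open>Finite groupoids and their wreaths\<close>

locale fin_groupoid =
  fixes C :: "('o, 'm) groupoid"
  assumes fin_groupoid: "finite_groupoid C"
begin

abbreviation comp (infixr "\<cdot>" 70) where "g \<cdot> f \<equiv> gcomp C g f"

lemma groupoid: "is_groupoid C" and finite_Obj: "finite (Obj C)" and finite_Mor: "finite (Mor C)"
  using fin_groupoid by (auto simp: finite_groupoid_def)

lemma finite_Hom: "finite (Hom C K L)"
  using finite_Mor by (auto simp: Hom_def)

lemma HomD:
  assumes "f \<in> Hom C K L"
  shows "f \<in> Mor C" "gdom C f = K" "gcod C f = L" "K \<in> Obj C" "L \<in> Obj C"
  using assms groupoid by (auto simp: Hom_def is_groupoid_def)

lemma gid_Hom: "K \<in> Obj C \<Longrightarrow> gid C K \<in> Hom C K K"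
  using groupoid by (simp add: is_groupoid_def)

lemma comp_Hom: "f \<in> Hom C K L \<Longrightarrow> g \<in> Hom C L M \<Longrightarrow> g \<cdot> f \<in> Hom C K M"
  using groupoid by (auto simp: is_groupoid_def Hom_def)

lemma comp_assoc:
  "f \<in> Hom C K L \<Longrightarrow> g \<in> Hom C L M \<Longrightarrow> h \<in> Hom C M N \<Longrightarrow> (h \<cdot> g) \<cdot> f = h \<cdot> (g \<cdot> f)"
  using groupoid by (auto simp: is_groupoid_def Hom_def)

lemma comp_gid: "f \<in> Hom C K L \<Longrightarrow> f \<cdot> gid C K = f"
  and gid_comp: "f \<in> Hom C K L \<Longrightarrow> gid C L \<cdot> f = f"
  using groupoid by (auto simp: is_groupoid_def Hom_def)

definition ginv :: "'m \<Rightarrow> 'm" where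
  "ginv f = (SOME g. g \<in> Hom C (gcod C f) (gdom C f) \<and>
     g \<cdot> f = gid C (gdom C f) \<and> f \<cdot> g = gid C (gcod C f))"

lemma
  assumes "f \<in> Hom C K L"
  shows ginv_Hom: "ginv f \<in> Hom C L K"
    and ginv_comp: "ginv f \<cdot> f = gid C K"
    and comp_ginv: "f \<cdot> ginv f = gid C L"
proof -
  have "\<exists>g. g \<in> Hom C (gcod C f) (gdom C f) \<and>
     g \<cdot> f = gid C (gdom C f) \<and> f \<cdot> g = gid C (gcod C f)"
    using groupoid HomD(1)[OF assms] unfolding is_groupoid_def Bex_def by simp
  from someI_ex[OF this, folded ginv_def]
  show "ginv f \<in> Hom C L K" "ginv f \<cdot> f = gid C K" "f \<cdot> ginv f = gid C L"
    by (simp_all add: HomD(2,3)[OF assms])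
qed

lemma comp_right_cancel:
  assumes f: "f \<in> Hom C K L" and g: "g \<in> Hom C L M" and h: "h \<in> Hom C L N" and "g \<cdot> f = h \<cdot> f"
  shows "g = h"
proof -
  have "g = (g \<cdot> f) \<cdot> ginv f"
    by (simp add: comp_assoc[OF ginv_Hom[OF f] f g] comp_ginv[OF f] comp_gid[OF g])
  also have "\<dots> = (h \<cdot> f) \<cdot> ginv f" using assms by simp
  also have "\<dots> = h"
    by (simp add: comp_assoc[OF ginv_Hom[OF f] f h] comp_ginv[OF f] comp_gid[OF h])
  finally show ?thesis .
qed

lemma comp_left_cancel:
  assumes f: "f \<in> Hom C K L" and g: "g \<in> Hom C M K" and h: "h \<in> Hom C N K" and "f \<cdot> g = f \<cdot> h"
  shows "g = h"
proof -
  have "g = ginv f \<cdot> (f \<cdot> g)"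
    by (simp add: comp_assoc[OF g f ginv_Hom[OF f], symmetric] ginv_comp[OF f] gid_comp[OF g])
  also have "\<dots> = ginv f \<cdot> (f \<cdot> h)" using assms by simp
  also have "\<dots> = h"
    by (simp add: comp_assoc[OF h f ginv_Hom[OF f], symmetric] ginv_comp[OF f] gid_comp[OF h])
  finally show ?thesis .
qed

lemma comp_ginv_cancel:
  assumes f: "f \<in> Hom C K L" and g: "g \<in> Hom C K M"
  shows "(g \<cdot> ginv f) \<cdot> f = g"
  by (simp add: comp_assoc[OF f ginv_Hom[OF f] g] ginv_comp[OF f] comp_gid[OF g])

section \<open>The wreath as a group\<close>

lemma wrD:
  assumes "\<rho> \<in> wr C"
  shows "snd \<rho> permutes Obj C" and "K \<in> Obj C \<Longrightarrow> fst \<rho> K \<in> Hom C K (snd \<rho> K)"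
    and "K \<in> Obj C \<Longrightarrow> snd \<rho> K \<in> Obj C" and "K \<notin> Obj C \<Longrightarrow> fst \<rho> K = undefined"
  using assms by (auto simp: wr_def permutes_in_image)

lemma wr_funpow_Obj: "\<rho> \<in> wr C \<Longrightarrow> K \<in> Obj C \<Longrightarrow> (snd \<rho> ^^ n) K \<in> Obj C"
  using permutes_in_funpow_image wrD(1) by metis

text \<open>The codomain of the component at \<open>K\<close> is the image of \<open>K\<close>, so
  the components determine the permutation on objects. Elsewhere the components are
  \<open>undefined\<close> and the permutation is the identity.\<close>

lemma wr_eqI:
  assumes "\<rho> \<in> wr C" "\<sigma> \<in> wr C" "\<And>K. K \<in> Obj C \<Longrightarrow> fst \<rho> K = fst \<sigma> K"
  shows "\<rho> = \<sigma>"
proof (rule prod_eqI)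
  show "fst \<rho> = fst \<sigma>"
    using assms wrD(4)[OF assms(1)] wrD(4)[OF assms(2)] by (metis ext)
  show "snd \<rho> = snd \<sigma>"
  proof
    fix K show "snd \<rho> K = snd \<sigma> K"
      using HomD(3)[OF wrD(2)[OF assms(1), of K]] HomD(3)[OF wrD(2)[OF assms(2), of K]] assms(3)[of K]
        wrD(1)[OF assms(1)] wrD(1)[OF assms(2)] by (metis permutes_not_in)
  qed
qed

lemma wr_mult_closed:
  assumes "\<rho> \<in> wr C" "\<sigma> \<in> wr C"
  shows "wr_mult C \<sigma> \<rho> \<in> wr C"
  using wrD(1)[OF assms(1)] wrD(1)[OF assms(2)]
    comp_Hom[OF wrD(2)[OF assms(1)] wrD(2)[OF assms(2) wrD(3)[OF assms(1)]]]
  by (auto simp: wr_mult_def wr_def permutes_compose)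

lemma wr_one_closed: "wr_one C \<in> wr C"
  by (auto simp: wr_one_def wr_def permutes_id gid_Hom)

lemma group_wr: "group (wr_group C)"
proof (rule groupI)
  fix \<rho> \<sigma> \<tau> assume *: "\<rho> \<in> carrier (wr_group C)" "\<sigma> \<in> carrier (wr_group C)" "\<tau> \<in> carrier (wr_group C)"
  then have w: "\<rho> \<in> wr C" "\<sigma> \<in> wr C" "\<tau> \<in> wr C" by (auto simp: wr_group_def)
  show "\<rho> \<otimes>\<^bsub>wr_group C\<^esub> \<sigma> \<otimes>\<^bsub>wr_group C\<^esub> \<tau> = \<rho> \<otimes>\<^bsub>wr_group C\<^esub> (\<sigma> \<otimes>\<^bsub>wr_group C\<^esub> \<tau>)"
    using w by (auto simp: wr_group_def intro!: wr_eqI wr_mult_closed)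
      (auto simp: wr_mult_def wrD intro!: comp_assoc wrD)
next
  fix \<rho> assume "\<rho> \<in> carrier (wr_group C)"
  then have w: "\<rho> \<in> wr C" by (auto simp: wr_group_def)
  then show "\<one>\<^bsub>wr_group C\<^esub> \<otimes>\<^bsub>wr_group C\<^esub> \<rho> = \<rho>"
    by (auto simp: wr_group_def intro!: wr_eqI wr_mult_closed wr_one_closed)
      (auto simp: wr_mult_def wr_one_def wrD intro!: gid_comp wrD)
  \<comment> \<open>The component of the inverse at \<open>K\<close> has to run from
    \<open>K\<close> to its preimage \<open>?t K\<close>. It inverts the component of \<rho> at
    \<open>?t K\<close>, which ends in \<open>K\<close>.\<close>
  let ?t = "inv_into UNIV (snd \<rho>)"
  let ?\<tau> = "((\<lambda>K. if K \<in> Obj C then ginv (fst \<rho> (?t K)) else undefined), ?t)"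
  note p = wrD(1)[OF w]
  have "?\<tau> \<in> wr C"
    unfolding wr_def
  proof (clarsimp simp: permutes_inv[OF p])
    fix K assume "K \<in> Obj C"
    then have "fst \<rho> (?t K) \<in> Hom C (?t K) K"
      using wrD(2)[OF w, of "?t K"] p by (simp add: permutes_in_image[OF permutes_inv] permutes_inverses)
    then show "ginv (fst \<rho> (?t K)) \<in> Hom C K (?t K)" by (rule ginv_Hom)
  qed
  moreover have "wr_mult C ?\<tau> \<rho> = wr_one C"
    using w by (intro wr_eqI wr_mult_closed wr_one_closed calculation)
      (auto simp: wr_mult_def wr_one_def wrD permutes_inverses[OF p] intro!: ginv_comp wrD)
  ultimately show "\<exists>\<tau>\<in>carrier (wr_group C). \<tau> \<otimes>\<^bsub>wr_group C\<^esub> \<rho> = \<one>\<^bsub>wr_group C\<^esub>"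
    by (auto simp: wr_group_def)
qed (auto simp: wr_group_def wr_mult_closed wr_one_closed)

section \<open>Transporters and products along orbits\<close>

definition transporter :: "('o, 'm) wr_elem \<Rightarrow> ('o, 'm) wr_elem \<Rightarrow> ('o, 'm) wr_elem set" where
  "transporter \<rho> \<sigma> = {\<alpha> \<in> wr C. wr_mult C \<alpha> \<rho> = wr_mult C \<sigma> \<alpha>}"

lemma transporter_self: "\<rho> \<in> wr C \<Longrightarrow> \<rho> \<in> transporter \<rho> \<rho>"
  by (simp add: transporter_def)

text \<open>Multiplying by \<alpha> on the right clears the inverse. Conjugacy is thereby decided by
  whether the set that the theorem counts is empty.\<close>

lemma wr_conjugate_iff:
  assumes "\<rho> \<in> wr C" "\<sigma> \<in> wr C"
  shows "wr_conjugate C \<rho> \<sigma> \<longleftrightarrow> transporter \<rho> \<sigma> \<noteq> {}"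
proof -
  interpret group "wr_group C" by (rule group_wr)
  have "\<alpha> \<otimes>\<^bsub>wr_group C\<^esub> \<rho> \<otimes>\<^bsub>wr_group C\<^esub> inv\<^bsub>wr_group C\<^esub> \<alpha> = \<sigma> \<longleftrightarrow>
      \<alpha> \<otimes>\<^bsub>wr_group C\<^esub> \<rho> = \<sigma> \<otimes>\<^bsub>wr_group C\<^esub> \<alpha>" if "\<alpha> \<in> carrier (wr_group C)" for \<alpha>
    using assms that inv_solve_right'[of \<sigma> "\<alpha> \<otimes>\<^bsub>wr_group C\<^esub> \<rho>" \<alpha>] by (auto simp: wr_group_def wr_mult_closed)
  then show ?thesis
    by (auto simp: wr_conjugate_def transporter_def wr_group_def)
qed

text \<open>The inverse of an element transporting \<rho> to \<sigma> transports \<sigma> to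
  \<rho>.\<close>

lemma transporter_sym:
  assumes "\<rho> \<in> wr C" "\<sigma> \<in> wr C" "transporter \<rho> \<sigma> \<noteq> {}"
  shows "transporter \<sigma> \<rho> \<noteq> {}"
proof -
  interpret group "wr_group C" by (rule group_wr)
  obtain \<alpha> where a: "\<alpha> \<in> carrier (wr_group C)" "\<alpha> \<otimes>\<^bsub>wr_group C\<^esub> \<rho> = \<sigma> \<otimes>\<^bsub>wr_group C\<^esub> \<alpha>"
    using assms(3) by (auto simp: transporter_def wr_group_def)
  have c: "\<rho> \<in> carrier (wr_group C)" "\<sigma> \<in> carrier (wr_group C)"
    using assms by (auto simp: wr_group_def)
  have "inv\<^bsub>wr_group C\<^esub> \<alpha> \<otimes>\<^bsub>wr_group C\<^esub> \<sigma> = \<rho> \<otimes>\<^bsub>wr_group C\<^esub> inv\<^bsub>wr_group C\<^esub> \<alpha>"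
    using a c by (metis inv_closed inv_solve_left inv_solve_right m_assoc m_closed)
  moreover have "inv\<^bsub>wr_group C\<^esub> \<alpha> \<in> carrier (wr_group C)" using a by simp
  ultimately have "inv\<^bsub>wr_group C\<^esub> \<alpha> \<in> transporter \<sigma> \<rho>"
    by (simp add: transporter_def wr_group_def)
  then show ?thesis by blast
qed

lemma transporterD:
  assumes "\<rho> \<in> wr C" "\<alpha> \<in> transporter \<rho> \<sigma>"
  shows "\<alpha> \<in> wr C" and "snd \<alpha> (snd \<rho> K) = snd \<sigma> (snd \<alpha> K)"
    and "K \<in> Obj C \<Longrightarrow> fst \<alpha> (snd \<rho> K) \<cdot> fst \<rho> K = fst \<sigma> (snd \<alpha> K) \<cdot> fst \<alpha> K"
  using assms by (auto simp: transporter_def wr_mult_def fun_eq_iff) metis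

lemma transporter_funpow:
  assumes "\<rho> \<in> wr C" "\<alpha> \<in> transporter \<rho> \<sigma>"
  shows "snd \<alpha> ((snd \<rho> ^^ n) K) = (snd \<sigma> ^^ n) (snd \<alpha> K)"
  by (induction n) (auto simp: transporterD(2)[OF assms])

lemma lam_iter_Hom:
  assumes "\<rho> \<in> wr C" "K \<in> Obj C"
  shows "lam_iter C \<rho> K n \<in> Hom C K ((snd \<rho> ^^ n) K)"
  by (induction n) (auto simp: gid_Hom assms wr_funpow_Obj intro!: comp_Hom wrD)

lemma lam_Hom:
  assumes "\<rho> \<in> wr C" "K \<in> Obj C"
  shows "lam C \<rho> K \<in> Hom C K K"
  using lam_iter_Hom[OF assms, of "orbit_len (snd \<rho>) K"]
  by (simp add: lam_def orbit_len_props(2)[OF finite_Obj wrD(1)[OF assms(1)]])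

text \<open>Each step along the orbit of \<open>K\<close> gives a commuting square, by comparing
  components in \<alpha>\<rho> = \<sigma>\<alpha>; \<open>n\<close> consecutive squares are pasted
  together.\<close>

lemma transporter_lam_iter:
  assumes "\<rho> \<in> wr C" "\<sigma> \<in> wr C" "\<alpha> \<in> transporter \<rho> \<sigma>" "K \<in> Obj C"
  shows "fst \<alpha> ((snd \<rho> ^^ n) K) \<cdot> lam_iter C \<rho> K n = lam_iter C \<sigma> (snd \<alpha> K) n \<cdot> fst \<alpha> K"
proof (induction n)
  case 0
  have "fst \<alpha> K \<in> Hom C K (snd \<alpha> K)" using wrD(2) transporterD(1) assms by blast
  then show ?case by (simp add: comp_gid gid_comp)
next
  case (Suc n)
  let ?L = "(snd \<rho> ^^ n) K" and ?P = "lam_iter C \<rho> K n" and ?Q = "lam_iter C \<sigma> (snd \<alpha> K) n"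
  note a = transporterD[OF assms(1,3)]
  have L: "?L \<in> Obj C" using wr_funpow_Obj assms by blast
  have P: "?P \<in> Hom C K ?L" using lam_iter_Hom assms by blast
  have Q: "?Q \<in> Hom C (snd \<alpha> K) (snd \<alpha> ?L)"
    using lam_iter_Hom[OF assms(2) wrD(3)[OF a(1) assms(4)]] transporter_funpow[OF assms(1,3)] by metis
  note \<alpha> = wrD[OF a(1)]
  have "fst \<alpha> (snd \<rho> ?L) \<cdot> (fst \<rho> ?L \<cdot> ?P) = (fst \<alpha> (snd \<rho> ?L) \<cdot> fst \<rho> ?L) \<cdot> ?P"
    by (rule comp_assoc[OF P wrD(2)[OF assms(1) L] \<alpha>(2)[OF wrD(3)[OF assms(1) L]], symmetric])
  also have "\<dots> = (fst \<sigma> (snd \<alpha> ?L) \<cdot> fst \<alpha> ?L) \<cdot> ?P" using a(3) L by simp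
  also have "\<dots> = fst \<sigma> (snd \<alpha> ?L) \<cdot> (fst \<alpha> ?L \<cdot> ?P)"
    by (rule comp_assoc[OF P \<alpha>(2)[OF L] wrD(2)[OF assms(2) \<alpha>(3)[OF L]]])
  also have "\<dots> = fst \<sigma> (snd \<alpha> ?L) \<cdot> (?Q \<cdot> fst \<alpha> K)" by (simp add: Suc)
  also have "\<dots> = (fst \<sigma> (snd \<alpha> ?L) \<cdot> ?Q) \<cdot> fst \<alpha> K"
    by (rule comp_assoc[OF \<alpha>(2)[OF assms(4)] Q wrD(2)[OF assms(2) \<alpha>(3)[OF L]], symmetric])
  finally show ?case by (simp add: transporter_funpow[OF assms(1,3)])
qed

text \<open>\<open>snd \<alpha>\<close> is injective and carries powers of \<open>snd \<rho>\<close>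
  to powers of \<open>snd \<sigma>\<close>, so a point and its image have the same periods.\<close>

lemma transporter_orbit_len:
  assumes "\<rho> \<in> wr C" "\<alpha> \<in> transporter \<rho> \<sigma>"
  shows "orbit_len (snd \<sigma>) (snd \<alpha> K) = orbit_len (snd \<rho>) K"
proof -
  have "inj (snd \<alpha>)" by (rule permutes_inj[OF wrD(1)[OF transporterD(1)[OF assms]]])
  then have "(snd \<sigma> ^^ n) (snd \<alpha> K) = snd \<alpha> K \<longleftrightarrow> (snd \<rho> ^^ n) K = K" for n
    unfolding transporter_funpow[OF assms, symmetric] by (auto simp: inj_eq)
  then show ?thesis by (simp add: orbit_len_def)
qed

text \<open>This is the pasted square after one full turn, which takes equally many steps on both
  sides.\<close>

lemma transporter_lam:
  assumes "\<rho> \<in> wr C" "\<sigma> \<in> wr C" "\<alpha> \<in> transporter \<rho> \<sigma>" "K \<in> Obj C"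
  shows "fst \<alpha> K \<cdot> lam C \<rho> K = lam C \<sigma> (snd \<alpha> K) \<cdot> fst \<alpha> K"
  using transporter_lam_iter[OF assms, of "orbit_len (snd \<rho>) K"]
    transporter_orbit_len[OF assms(1,3), of K]
    orbit_len_props(2)[OF finite_Obj wrD(1)[OF assms(1)], of K]
  by (simp add: lam_def)

section \<open>Intertwiners, conjugacy classes and centralizers\<close>

definition intertwiners :: "'m \<Rightarrow> 'm \<Rightarrow> 'm set" where
  "intertwiners \<gamma> \<beta> = {f \<in> Hom C (gdom C \<gamma>) (gdom C \<beta>). f \<cdot> \<gamma> = \<beta> \<cdot> f}"

lemma aut_Hom: "\<gamma> \<in> aut C \<Longrightarrow> \<gamma> \<in> Hom C (gdom C \<gamma>) (gdom C \<gamma>)"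
  by (auto simp: aut_def Hom_def)

lemma Hom_aut: "\<gamma> \<in> Hom C K K \<Longrightarrow> \<gamma> \<in> aut C"
  by (auto simp: aut_def Hom_def)

lemma finite_intertwiners: "finite (intertwiners \<gamma> \<beta>)"
  using finite_Hom by (simp add: intertwiners_def)

lemma intertwinersD:
  "f \<in> intertwiners \<gamma> \<beta> \<Longrightarrow> f \<in> Hom C (gdom C \<gamma>) (gdom C \<beta>)"
  "f \<in> intertwiners \<gamma> \<beta> \<Longrightarrow> f \<cdot> \<gamma> = \<beta> \<cdot> f"
  by (auto simp: intertwiners_def)

lemma intertwiners_comp:
  assumes "\<gamma> \<in> aut C" "\<beta> \<in> aut C" "\<delta> \<in> aut C" "f \<in> intertwiners \<gamma> \<beta>" "g \<in> intertwiners \<beta> \<delta>"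
  shows "g \<cdot> f \<in> intertwiners \<gamma> \<delta>"
proof -
  note f = intertwinersD[OF assms(4)] and g = intertwinersD[OF assms(5)]
  have "(g \<cdot> f) \<cdot> \<gamma> = (g \<cdot> \<beta>) \<cdot> f"
    by (simp add: comp_assoc[OF aut_Hom[OF assms(1)] f(1) g(1)]
        comp_assoc[OF f(1) aut_Hom[OF assms(2)] g(1)] f(2))
  also have "\<dots> = \<delta> \<cdot> (g \<cdot> f)"
    by (simp add: comp_assoc[OF f(1) g(1) aut_Hom[OF assms(3)]] g(2))
  finally show ?thesis using comp_Hom[OF f(1) g(1)] by (simp add: intertwiners_def)
qed

lemma intertwiners_ginv:
  assumes "\<gamma> \<in> aut C" "\<beta> \<in> aut C" "f \<in> intertwiners \<gamma> \<beta>"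
  shows "ginv f \<in> intertwiners \<beta> \<gamma>"
proof -
  note f = intertwinersD[OF assms(3)] and g = aut_Hom[OF assms(1)] and b = aut_Hom[OF assms(2)]
  \<comment> \<open>The two sides of the wanted equation are compared after composing with
    \<open>f\<close> on the right, where both become \<gamma>.\<close>
  have "(ginv f \<cdot> \<beta>) \<cdot> f = (ginv f \<cdot> f) \<cdot> \<gamma>"
    by (simp add: comp_assoc[OF f(1) b ginv_Hom[OF f(1)]] comp_assoc[OF g f(1) ginv_Hom[OF f(1)]] f(2))
  also have "\<dots> = (\<gamma> \<cdot> ginv f) \<cdot> f"
    by (simp add: ginv_comp[OF f(1)] gid_comp[OF g] comp_ginv_cancel[OF f(1) g])
  finally have "ginv f \<cdot> \<beta> = \<gamma> \<cdot> ginv f"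
    by (rule comp_right_cancel[OF f(1) comp_Hom[OF b ginv_Hom[OF f(1)]] comp_Hom[OF ginv_Hom[OF f(1)] g]])
  then show ?thesis using ginv_Hom[OF f(1)] by (simp add: intertwiners_def)
qed

text \<open>Composing with \<open>f\<close> on the right embeds
  \<open>intertwiners \<beta> \<delta>\<close> into \<open>intertwiners \<gamma> \<delta>\<close>.
  Applying the same inequality to \<open>ginv f\<close> gives the converse one.\<close>

lemma card_intertwiners_source:
  assumes "\<gamma> \<in> aut C" "\<beta> \<in> aut C" "\<delta> \<in> aut C" "f \<in> intertwiners \<gamma> \<beta>"
  shows "card (intertwiners \<beta> \<delta>) = card (intertwiners \<gamma> \<delta>)"
proof -
  have "card (intertwiners \<beta> \<delta>) \<le> card (intertwiners \<gamma> \<delta>)"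
    if "\<gamma> \<in> aut C" "\<beta> \<in> aut C" "f \<in> intertwiners \<gamma> \<beta>" for \<gamma> \<beta> f
  proof (rule card_inj_on_le)
    show "inj_on (\<lambda>h. h \<cdot> f) (intertwiners \<beta> \<delta>)"
      using comp_right_cancel[OF intertwinersD(1)[OF that(3)] intertwinersD(1) intertwinersD(1)]
      by (rule inj_onI)
  qed (use that assms(3) in \<open>auto simp: finite_intertwiners intro: intertwiners_comp\<close>)
  from this[OF assms(1,2,4)] this[OF assms(2,1) intertwiners_ginv[OF assms(1,2,4)]]
  show ?thesis by simp
qed

lemma card_intertwiners_target:
  assumes "\<gamma> \<in> aut C" "\<beta> \<in> aut C" "\<delta> \<in> aut C" "f \<in> intertwiners \<gamma> \<beta>"
  shows "card (intertwiners \<delta> \<gamma>) = card (intertwiners \<delta> \<beta>)"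
proof -
  have "card (intertwiners \<delta> \<gamma>) \<le> card (intertwiners \<delta> \<beta>)"
    if "\<gamma> \<in> aut C" "\<beta> \<in> aut C" "f \<in> intertwiners \<gamma> \<beta>" for \<gamma> \<beta> f
  proof (rule card_inj_on_le)
    show "inj_on (\<lambda>h. f \<cdot> h) (intertwiners \<delta> \<gamma>)"
      using comp_left_cancel[OF intertwinersD(1)[OF that(3)] intertwinersD(1) intertwinersD(1)]
      by (rule inj_onI)
  qed (use that assms(3) in \<open>auto simp: finite_intertwiners intro: intertwiners_comp\<close>)
  from this[OF assms(1,2,4)] this[OF assms(2,1) intertwiners_ginv[OF assms(1,2,4)]]
  show ?thesis by simp
qed

lemma gconj_iff: "gconj C \<gamma> \<beta> \<longleftrightarrow> \<gamma> \<in> aut C \<and> \<beta> \<in> aut C \<and> (\<exists>f. f \<in> intertwiners \<gamma> \<beta>)"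
  by (auto simp: gconj_def intertwiners_def)

lemma gconj_refl:
  assumes "\<gamma> \<in> aut C"
  shows "gconj C \<gamma> \<gamma>"
proof -
  note g = aut_Hom[OF assms]
  have "gid C (gdom C \<gamma>) \<in> intertwiners \<gamma> \<gamma>"
    using gid_Hom[OF HomD(4)[OF g]] by (simp add: intertwiners_def comp_gid[OF g] gid_comp[OF g])
  then show ?thesis using assms by (auto simp: gconj_iff)
qed

lemma gconj_sym: "gconj C \<gamma> \<beta> \<Longrightarrow> gconj C \<beta> \<gamma>"
  unfolding gconj_iff using intertwiners_ginv by blast

lemma gconj_trans: "gconj C \<gamma> \<beta> \<Longrightarrow> gconj C \<beta> \<delta> \<Longrightarrow> gconj C \<gamma> \<delta>"
  unfolding gconj_iff using intertwiners_comp by blast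

text \<open>The assumption excludes two morphisms that are not automorphisms: their classes are both
  empty, hence equal, although \<open>gconj\<close> fails.\<close>

lemma conj_class_eq_iff:
  assumes "\<beta> \<in> aut C"
  shows "conj_class C \<gamma> = conj_class C \<beta> \<longleftrightarrow> gconj C \<gamma> \<beta>"
proof
  assume "conj_class C \<gamma> = conj_class C \<beta>"
  then have "\<beta> \<in> conj_class C \<gamma>" using gconj_refl[OF assms] by (simp add: conj_class_def)
  then show "gconj C \<gamma> \<beta>" by (simp add: conj_class_def)
next
  assume "gconj C \<gamma> \<beta>"
  then show "conj_class C \<gamma> = conj_class C \<beta>"
    unfolding conj_class_def by (blast intro: gconj_sym gconj_trans)
qed

lemma conj_class_eq: "gconj C \<gamma> \<beta> \<Longrightarrow> conj_class C \<beta> = conj_class C \<gamma>"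
  by (simp add: conj_class_eq_iff gconj_sym gconj_iff[of \<gamma>])

text \<open>\<open>intertwiners \<delta> \<delta>\<close> is the centralizer of \<delta>. Moving
  either end within the conjugacy class keeps the cardinality, so both ends can be moved to the
  representative that \<open>cent_card\<close> picks.\<close>

lemma card_intertwiners:
  assumes "gconj C \<gamma> \<beta>"
  shows "card (intertwiners \<gamma> \<beta>) = cent_card C (conj_class C \<gamma>)"
proof -
  define \<delta> where "\<delta> = (SOME \<delta>. \<delta> \<in> conj_class C \<gamma>)"
  have "gconj C \<gamma> \<delta>"
    using someI[of "\<lambda>\<delta>. \<delta> \<in> conj_class C \<gamma>" \<beta>] assms by (simp add: \<delta>_def conj_class_def)
  then obtain f g where fg: "f \<in> intertwiners \<gamma> \<delta>" "g \<in> intertwiners \<gamma> \<beta>"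
    and a: "\<gamma> \<in> aut C" "\<delta> \<in> aut C" "\<beta> \<in> aut C"
    using assms by (auto simp: gconj_iff)
  have "card (intertwiners \<gamma> \<beta>) = card (intertwiners \<gamma> \<gamma>)"
    using card_intertwiners_target[OF a(1,3,1) fg(2)] by simp
  also have "\<dots> = card (intertwiners \<gamma> \<delta>)"
    by (rule card_intertwiners_target[OF a(1,2,1) fg(1)])
  also have "\<dots> = card (intertwiners \<delta> \<delta>)"
    using card_intertwiners_source[OF a(1,2,2) fg(1)] by simp
  also have "\<dots> = cent_card C (conj_class C \<gamma>)"
    by (simp add: cent_card_def centralizer_def Aut_def intertwiners_def \<delta>_def)
  finally show ?thesis .
qed

lemma cent_card_pos:
  assumes "X \<in> digamma C"
  shows "cent_card C X > 0"
proof -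
  obtain \<gamma> where g: "\<gamma> \<in> aut C" "X = conj_class C \<gamma>" using assms by (auto simp: digamma_def)
  then have "intertwiners \<gamma> \<gamma> \<noteq> {}" using gconj_refl gconj_iff by blast
  then show ?thesis
    using card_intertwiners[OF gconj_refl[OF g(1)]] finite_intertwiners g(2) by (metis card_gt_0_iff)
qed

section \<open>Counting transporters\<close>

text \<open>The index (k, [\<gamma>]) under which \<open>cyc\<close> counts the orbit of
  \<open>K\<close>.\<close>

definition orbit_type :: "('o, 'm) wr_elem \<Rightarrow> 'o \<Rightarrow> nat \<times> 'm set" where
  "orbit_type \<rho> K = (orbit_len (snd \<rho>) K, label C \<rho> K)"

definition orbits :: "('o, 'm) wr_elem \<Rightarrow> nat \<times> 'm set \<Rightarrow> 'o set set" where
  "orbits \<rho> u = {orb (snd \<rho>) K | K. K \<in> Obj C \<and> orbit_type \<rho> K = u}"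

lemma cyc_eq_card_orbits: "cyc C \<rho> k X = card (orbits \<rho> (k, X))"
  by (simp add: cyc_def orbits_def orbit_type_def)

lemma finite_orbits: "finite (orbits \<rho> u)"
  using finite_Obj by (simp add: orbits_def)

lemma lam_aut: "\<rho> \<in> wr C \<Longrightarrow> K \<in> Obj C \<Longrightarrow> lam C \<rho> K \<in> aut C"
  using lam_Hom Hom_aut by blast

lemma intertwiners_lam_iff:
  assumes "\<rho> \<in> wr C" "\<sigma> \<in> wr C" "K \<in> Obj C" "L \<in> Obj C"
  shows "f \<in> intertwiners (lam C \<rho> K) (lam C \<sigma> L) \<longleftrightarrow>
    f \<in> Hom C K L \<and> f \<cdot> lam C \<rho> K = lam C \<sigma> L \<cdot> f"
  using HomD(2)[OF lam_Hom[OF assms(1,3)]] HomD(2)[OF lam_Hom[OF assms(2,4)]]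
  by (simp add: intertwiners_def)

lemma transporter_orbit_type:
  assumes "\<rho> \<in> wr C" "\<sigma> \<in> wr C" "\<alpha> \<in> transporter \<rho> \<sigma>" "K \<in> Obj C"
  shows "orbit_type \<sigma> (snd \<alpha> K) = orbit_type \<rho> K"
proof -
  note a = wrD[OF transporterD(1)[OF assms(1,3)]]
  have "fst \<alpha> K \<in> intertwiners (lam C \<rho> K) (lam C \<sigma> (snd \<alpha> K))"
    using a(2,3)[OF assms(4)] transporter_lam[OF assms] by (simp add: intertwiners_lam_iff assms)
  then have "gconj C (lam C \<rho> K) (lam C \<sigma> (snd \<alpha> K))"
    using lam_aut assms a(3) by (auto simp: gconj_iff)
  from conj_class_eq[OF this] show ?thesis
    using transporter_orbit_len[OF assms(1,3)] by (simp add: orbit_type_def label_def)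
qed

text \<open>\<rho> commutes with itself, so it belongs to \<open>transporter \<rho> \<rho>\<close>
  and preserves types. Hence the label does not depend on the point chosen in the orbit.\<close>

lemma orbit_type_funpow:
  assumes "\<rho> \<in> wr C" "K \<in> Obj C"
  shows "orbit_type \<rho> ((snd \<rho> ^^ n) K) = orbit_type \<rho> K"
  by (induction n) (simp_all add: assms wr_funpow_Obj
      transporter_orbit_type[OF assms(1,1) transporter_self[OF assms(1)]])

lemma orb_mem_orbits_iff:
  assumes "\<rho> \<in> wr C" "K \<in> Obj C"
  shows "orb (snd \<rho>) K \<in> orbits \<rho> u \<longleftrightarrow> orbit_type \<rho> K = u"
proof
  assume "orb (snd \<rho>) K \<in> orbits \<rho> u"
  then obtain L where L: "L \<in> Obj C" "orb (snd \<rho>) K = orb (snd \<rho>) L" "orbit_type \<rho> L = u"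
    by (auto simp: orbits_def)
  then have "K \<in> orb (snd \<rho>) L" using orb_self by metis
  then show "orbit_type \<rho> K = u"
    using orbit_type_funpow[OF assms(1) L(1)] L(3) by (auto simp: orb_def)
qed (use assms in \<open>auto simp: orbits_def\<close>)

lemma orbits_disjoint:
  assumes "\<rho> \<in> wr C" "u \<noteq> v"
  shows "orbits \<rho> u \<inter> orbits \<rho> v = {}"
proof -
  have "u = v" if B: "B \<in> orbits \<rho> u" "B \<in> orbits \<rho> v" for B
  proof -
    obtain K where "K \<in> Obj C" "B = orb (snd \<rho>) K" using B(1) by (auto simp: orbits_def)
    then show ?thesis using B orb_mem_orbits_iff[OF assms(1)] by metis
  qed
  then show ?thesis using assms(2) by blast
qed

text \<open>Orbits are no larger than the set of objects, so all products over types can run over a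
  finite index set.\<close>

lemma orbit_type_range:
  assumes "\<rho> \<in> wr C" "K \<in> Obj C"
  shows "orbit_type \<rho> K \<in> {1..card (Obj C)} \<times> digamma C"
  using orbit_len_props(1)[OF finite_Obj wrD(1)[OF assms(1)], of K] lam_aut[OF assms]
    orbit_len_le[OF finite_Obj wrD(1)[OF assms(1)] assms(2)]
  by (auto simp: orbit_type_def digamma_def label_def)

text \<open>The candidates for the component at \<open>K\<close> of an element of
  \<open>transporter \<rho> \<sigma>\<close>. The codomain is left free because choosing
  \<open>f\<close> also chooses the image of \<open>K\<close>.\<close>

definition branches :: "('o, 'm) wr_elem \<Rightarrow> ('o, 'm) wr_elem \<Rightarrow> 'o \<Rightarrow> 'm set" where
  "branches \<rho> \<sigma> K = {f \<in> Mor C. gdom C f = K \<and> orbit_len (snd \<sigma>) (gcod C f) = orbit_len (snd \<rho>) K \<and>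
     f \<cdot> lam C \<rho> K = lam C \<sigma> (gcod C f) \<cdot> f}"

lemma finite_branches: "finite (branches \<rho> \<sigma> K)"
  using finite_Mor by (simp add: branches_def)

text \<open>An intertwiner \<open>f\<close> itself witnesses that the two values of
  \<open>lam\<close> are conjugate, so equality of labels is automatic and \<open>branches\<close>
  demands only equality of lengths.\<close>

lemma branches_iff:
  assumes "\<rho> \<in> wr C" "\<sigma> \<in> wr C" "K \<in> Obj C"
  shows "f \<in> branches \<rho> \<sigma> K \<longleftrightarrow> gcod C f \<in> Obj C \<and> orbit_type \<sigma> (gcod C f) = orbit_type \<rho> K \<and>
    f \<in> intertwiners (lam C \<rho> K) (lam C \<sigma> (gcod C f))"
proof
  assume f: "f \<in> branches \<rho> \<sigma> K"
  then have h: "f \<in> Hom C K (gcod C f)" by (simp add: branches_def Hom_def)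
  note L = HomD(5)[OF h]
  have i: "f \<in> intertwiners (lam C \<rho> K) (lam C \<sigma> (gcod C f))"
    using f h by (simp add: branches_def intertwiners_lam_iff[OF assms L])
  then have "gconj C (lam C \<rho> K) (lam C \<sigma> (gcod C f))"
    using lam_aut L assms by (auto simp: gconj_iff)
  from conj_class_eq[OF this] have "orbit_type \<sigma> (gcod C f) = orbit_type \<rho> K"
    using f by (simp add: orbit_type_def label_def branches_def)
  then show "gcod C f \<in> Obj C \<and> orbit_type \<sigma> (gcod C f) = orbit_type \<rho> K \<and>
    f \<in> intertwiners (lam C \<rho> K) (lam C \<sigma> (gcod C f))" using L i by simp
next
  assume f: "gcod C f \<in> Obj C \<and> orbit_type \<sigma> (gcod C f) = orbit_type \<rho> K \<and>
    f \<in> intertwiners (lam C \<rho> K) (lam C \<sigma> (gcod C f))"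
  then show "f \<in> branches \<rho> \<sigma> K"
    using intertwiners_lam_iff[OF assms, of "gcod C f" f] by (auto simp: branches_def Hom_def orbit_type_def)
qed

text \<open>\<open>B\<close> has as many points \<open>L\<close> as the orbit of \<open>K\<close>.
  The candidates ending in \<open>L\<close> are the intertwiners from \<open>lam C \<rho> K\<close>
  to \<open>lam C \<sigma> L\<close>, and agreement of labels makes their number the size of the
  centralizer.\<close>

lemma card_branches_fibre:
  assumes "\<rho> \<in> wr C" "\<sigma> \<in> wr C" "K \<in> Obj C" "B \<in> orbits \<sigma> (orbit_type \<rho> K)"
  shows "card {f \<in> branches \<rho> \<sigma> K. orb (snd \<sigma>) (gcod C f) = B} =
    fst (orbit_type \<rho> K) * cent_card C (snd (orbit_type \<rho> K))"
proof -
  note p = finite_Obj wrD(1)[OF assms(2)]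
  obtain M where M: "M \<in> Obj C" "orbit_type \<sigma> M = orbit_type \<rho> K" "B = orb (snd \<sigma>) M"
    using assms(4) by (auto simp: orbits_def)
  have "card {f \<in> branches \<rho> \<sigma> K. orb (snd \<sigma>) (gcod C f) = B} =
      card B * cent_card C (snd (orbit_type \<rho> K))"
  proof (rule card_UN_fibres[where q = "gcod C"])
    show "finite B" by (simp add: M finite_orb[OF p])
    show "gcod C f \<in> B" if "f \<in> {f \<in> branches \<rho> \<sigma> K. orb (snd \<sigma>) (gcod C f) = B}" for f
      using that orb_self[of "gcod C f" "snd \<sigma>"] by auto
    fix L assume L: "L \<in> B"
    then have Lo: "L \<in> Obj C" using M orb_subset[OF p(2)] by blast
    have "orb (snd \<sigma>) L = B" using L M(3) orb_eq_of_mem[OF p] by simp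
    moreover have t: "orbit_type \<sigma> L = orbit_type \<rho> K"
      using L M orbit_type_funpow[OF assms(2) M(1)] by (auto simp: orb_def)
    moreover have "gcod C f = L" if "f \<in> intertwiners (lam C \<rho> K) (lam C \<sigma> L)" for f
      using that by (auto simp: intertwiners_lam_iff[OF assms(1-3) Lo] dest: HomD(3))
    ultimately have "{f \<in> {f \<in> branches \<rho> \<sigma> K. orb (snd \<sigma>) (gcod C f) = B}. gcod C f = L} =
        intertwiners (lam C \<rho> K) (lam C \<sigma> L)"
      using Lo by (auto simp: branches_iff[OF assms(1-3)])
    moreover have "gconj C (lam C \<rho> K) (lam C \<sigma> L)"
      using t lam_aut[OF assms(2) Lo] by (simp add: orbit_type_def label_def flip: conj_class_eq_iff)
    ultimately show "card {f \<in> {f \<in> branches \<rho> \<sigma> K. orb (snd \<sigma>) (gcod C f) = B}. gcod C f = L} =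
        cent_card C (snd (orbit_type \<rho> K))"
      using card_intertwiners by (simp add: orbit_type_def label_def)
  qed (simp add: finite_branches)
  moreover have "card B = fst (orbit_type \<rho> K)"
    using M by (simp add: card_orb[OF p] orbit_type_def)
  ultimately show ?thesis by simp
qed

section \<open>Orbit representatives and reconstruction from them\<close>

definition transversal :: "('o \<Rightarrow> 'o) \<Rightarrow> 'o set \<Rightarrow> bool" where
  "transversal r R \<longleftrightarrow> R \<subseteq> Obj C \<and> inj_on (orb r) R \<and> orb r ` R = orb r ` Obj C"

lemma ex_transversal: "\<exists>R. transversal r R"
proof -
  obtain R where "R \<subseteq> Obj C" "inj_on (orb r) R" "orb r ` Obj C = orb r ` R"
    using subset_image_inj[THEN iffD1, OF subset_refl] by metis
  then show ?thesis unfolding transversal_def by metis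
qed

context
  fixes \<rho> \<sigma> :: "('o, 'm) wr_elem" and R :: "'o set"
  assumes \<rho>: "\<rho> \<in> wr C" and \<sigma>: "\<sigma> \<in> wr C" and R: "transversal (snd \<rho>) R"
begin

lemma transversal_subset: "K \<in> R \<Longrightarrow> K \<in> Obj C"
  and transversal_inj: "K \<in> R \<Longrightarrow> L \<in> R \<Longrightarrow> orb (snd \<rho>) K = orb (snd \<rho>) L \<Longrightarrow> K = L"
  using R by (auto simp: transversal_def dest: inj_onD)

lemma transversal_reach:
  assumes "L \<in> Obj C"
  obtains K n where "K \<in> R" "n < orbit_len (snd \<rho>) K" "(snd \<rho> ^^ n) K = L"
proof -
  note p = finite_Obj wrD(1)[OF \<rho>]
  have "orb (snd \<rho>) L \<in> orb (snd \<rho>) ` R" using assms R by (auto simp: transversal_def)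
  then obtain K where K: "K \<in> R" "orb (snd \<rho>) L = orb (snd \<rho>) K" by auto
  then have "L \<in> orb (snd \<rho>) K" using orb_self by metis
  then show ?thesis using that[OF K(1)] orb_eq_image[OF p, of K] by auto
qed

lemma transversal_unique:
  assumes "K \<in> R" "n < orbit_len (snd \<rho>) K" "K' \<in> R" "n' < orbit_len (snd \<rho>) K'"
    and "(snd \<rho> ^^ n) K = (snd \<rho> ^^ n') K'"
  shows "K = K'" and "n = n'"
proof -
  note p = finite_Obj wrD(1)[OF \<rho>]
  have "orb (snd \<rho>) K = orb (snd \<rho>) ((snd \<rho> ^^ n) K)"
    by (rule orb_eq_of_mem[OF p, symmetric]) (auto simp: orb_def)
  also have "\<dots> = orb (snd \<rho>) K'"
    unfolding assms(5) by (rule orb_eq_of_mem[OF p]) (auto simp: orb_def)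
  finally show "K = K'" using transversal_inj assms by blast
  then show "n = n'" using inj_onD[OF inj_on_funpow_orbit[OF p, of K], of n n'] assms by simp
qed

text \<open>By the pasted squares, the component at a point \<open>(snd \<rho> ^^ n) K\<close>,
  composed with \<open>lam_iter C \<rho> K n\<close>, depends only on the component at
  \<open>K\<close>. The common right factor cancels.\<close>

lemma transporter_eqI:
  assumes \<alpha>: "\<alpha> \<in> transporter \<rho> \<sigma>" and \<beta>: "\<beta> \<in> transporter \<rho> \<sigma>"
    and eq: "\<And>K. K \<in> R \<Longrightarrow> fst \<alpha> K = fst \<beta> K"
  shows "\<alpha> = \<beta>"
proof (rule wr_eqI)
  note a = wrD[OF transporterD(1)[OF \<rho> \<alpha>]] and b = wrD[OF transporterD(1)[OF \<rho> \<beta>]]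
  fix L assume "L \<in> Obj C"
  then obtain K n where K: "K \<in> R" "(snd \<rho> ^^ n) K = L" using transversal_reach by metis
  note Ko = transversal_subset[OF K(1)]
  have "snd \<alpha> K = snd \<beta> K"
    using HomD(3)[OF a(2)[OF Ko]] HomD(3)[OF b(2)[OF Ko]] eq[OF K(1)] by simp
  then have "fst \<alpha> L \<cdot> lam_iter C \<rho> K n = fst \<beta> L \<cdot> lam_iter C \<rho> K n"
    using transporter_lam_iter[OF \<rho> \<sigma> \<alpha> Ko, of n] transporter_lam_iter[OF \<rho> \<sigma> \<beta> Ko, of n] K eq
    by simp
  then show "fst \<alpha> L = fst \<beta> L"
    using comp_right_cancel[OF lam_iter_Hom[OF \<rho> Ko, of n]] K(2) a(2)[OF \<open>L \<in> Obj C\<close>] b(2)[OF \<open>L \<in> Obj C\<close>]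
    by blast
qed (use transporterD(1)[OF \<rho>] \<alpha> \<beta> in auto)

lemma transporter_inj: "inj_on (\<lambda>\<alpha>. restrict (fst \<alpha>) R) (transporter \<rho> \<sigma>)"
proof (rule inj_onI)
  fix \<alpha> \<beta> assume ab: "\<alpha> \<in> transporter \<rho> \<sigma>" "\<beta> \<in> transporter \<rho> \<sigma>"
    and "restrict (fst \<alpha>) R = restrict (fst \<beta>) R"
  then have "fst \<alpha> K = fst \<beta> K" if "K \<in> R" for K using that by (metis restrict_apply')
  then show "\<alpha> = \<beta>" using transporter_eqI[OF ab] by blast
qed

lemma transporter_restrict:
  assumes \<alpha>: "\<alpha> \<in> transporter \<rho> \<sigma>"
  shows "restrict (fst \<alpha>) R \<in> {g \<in> PiE R (branches \<rho> \<sigma>). inj_on (\<lambda>K. orb (snd \<sigma>) (gcod C (g K))) R}"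
proof -
  note a = wrD[OF transporterD(1)[OF \<rho> \<alpha>]]
  have cod: "gcod C (fst \<alpha> K) = snd \<alpha> K" if "K \<in> R" for K
    using a(2)[OF transversal_subset[OF that]] by (rule HomD(3))
  have "fst \<alpha> K \<in> branches \<rho> \<sigma> K" if K: "K \<in> R" for K
    using transporter_lam[OF \<rho> \<sigma> \<alpha> transversal_subset[OF K]] transporter_orbit_len[OF \<rho> \<alpha>]
      HomD(1,2)[OF a(2)[OF transversal_subset[OF K]]] by (simp add: branches_def cod[OF K])
  \<comment> \<open>If two representatives reach the same \<sigma>-orbit, pulling back along the
    injective map \<open>snd \<alpha>\<close> places them in one \<rho>-orbit.\<close>
  moreover have "inj_on (\<lambda>K. orb (snd \<sigma>) (snd \<alpha> K)) R"
  proof (rule inj_onI)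
    fix K L assume KL: "K \<in> R" "L \<in> R" "orb (snd \<sigma>) (snd \<alpha> K) = orb (snd \<sigma>) (snd \<alpha> L)"
    then have "snd \<alpha> K \<in> orb (snd \<sigma>) (snd \<alpha> L)" using orb_self by metis
    then obtain n where "snd \<alpha> K = snd \<alpha> ((snd \<rho> ^^ n) L)"
      by (auto simp: orb_def transporter_funpow[OF \<rho> \<alpha>])
    then have "K = (snd \<rho> ^^ n) L" using permutes_inj[OF a(1)] by (simp add: inj_eq)
    then have "K \<in> orb (snd \<rho>) L" by (auto simp: orb_def)
    then show "K = L"
      using orb_eq_of_mem[OF finite_Obj wrD(1)[OF \<rho>]] transversal_inj KL by blast
  qed
  then have "inj_on (\<lambda>K. orb (snd \<sigma>) (gcod C (restrict (fst \<alpha>) R K))) R"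
    by (subst inj_on_cong[where g = "\<lambda>K. orb (snd \<sigma>) (snd \<alpha> K)"]) (auto simp: cod)
  ultimately show ?thesis by auto
qed

lemma transporter_extend:
  assumes g: "g \<in> PiE R (branches \<rho> \<sigma>)" and inj: "inj_on (\<lambda>K. orb (snd \<sigma>) (gcod C (g K))) R"
  shows "\<exists>\<alpha> \<in> transporter \<rho> \<sigma>. restrict (fst \<alpha>) R = g"
proof -
  let ?r = "snd \<rho>" and ?s = "snd \<sigma>" and ?P = "lam_iter C \<rho>" and ?Q = "lam_iter C \<sigma>"
  note p = finite_Obj wrD(1)[OF \<rho>] and q = finite_Obj wrD(1)[OF \<sigma>]
  define c where "c K = gcod C (g K)" for K
  have gK: "g K \<in> Hom C K (c K)" "orbit_len ?s (c K) = orbit_len ?r K"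
    "g K \<cdot> lam C \<rho> K = lam C \<sigma> (c K) \<cdot> g K" if "K \<in> R" for K
    using PiE_mem[OF g that] by (auto simp: branches_def Hom_def c_def)
  have "\<forall>L\<in>Obj C. \<exists>K n. K \<in> R \<and> n < orbit_len ?r K \<and> (?r ^^ n) K = L"
    using transversal_reach by metis
  then obtain rep pos where rp: "\<And>L. L \<in> Obj C \<Longrightarrow>
      rep L \<in> R \<and> pos L < orbit_len ?r (rep L) \<and> (?r ^^ pos L) (rep L) = L"
    by metis
  have rp_eq: "rep ((?r ^^ n) K) = K \<and> pos ((?r ^^ n) K) = n"
    if "K \<in> R" "n < orbit_len ?r K" for K n
    using rp[of "(?r ^^ n) K"] transversal_unique[of "rep ((?r ^^ n) K)" "pos ((?r ^^ n) K)" K n] that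
      wr_funpow_Obj[OF \<rho> transversal_subset] by blast
  \<comment> \<open>The value is forced by \<open>transporter_lam_iter\<close>: go back along \<rho>
    from \<open>L\<close> to its representative, apply \<open>g\<close> there, then go forward along
    \<sigma> by the same number of steps.\<close>
  define f where "f L = (if L \<in> Obj C then (?Q (c (rep L)) (pos L) \<cdot> g (rep L)) \<cdot> ginv (?P (rep L) (pos L))
      else undefined)" for L
  define a where "a L = (if L \<in> Obj C then (?s ^^ pos L) (c (rep L)) else L)" for L
  have co: "c K \<in> Obj C" if "K \<in> R" for K using HomD(5)[OF gK(1)[OF that]] .
  have QHom: "?Q (c K) n \<cdot> g K \<in> Hom C K ((?s ^^ n) (c K))" if "K \<in> R" for K n
    using comp_Hom[OF gK(1)[OF that] lam_iter_Hom[OF \<sigma> co[OF that]]] .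
  have PHom: "?P K n \<in> Hom C K ((?r ^^ n) K)" if "K \<in> R" for K n
    using lam_iter_Hom[OF \<rho> transversal_subset[OF that]] .
  have fHom: "f L \<in> Hom C L (a L)" if "L \<in> Obj C" for L
  proof -
    have "ginv (?P (rep L) (pos L)) \<in> Hom C L (rep L)"
      using ginv_Hom[OF PHom, of "rep L" "pos L"] rp[OF that] by simp
    from comp_Hom[OF this QHom] show ?thesis using rp[OF that] that by (simp add: f_def a_def)
  qed
  have pow: "f ((?r ^^ n) K) \<cdot> ?P K n = ?Q (c K) n \<cdot> g K" "a ((?r ^^ n) K) = (?s ^^ n) (c K)"
    if "K \<in> R" "n < orbit_len ?r K" for K n
    using rp_eq[OF that] wr_funpow_Obj[OF \<rho> transversal_subset[OF that(1)], of n]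
      comp_ginv_cancel[OF PHom[OF that(1), of n] QHom[OF that(1), of n]]
    by (simp_all add: f_def a_def)
  \<comment> \<open>The new case is \<open>n\<close> equal to the orbit length, where the point has
    returned to position 0. There the equation is the intertwining condition on \<open>g K\<close>,
    and equality of the lengths makes the \<sigma>-orbit close up at the same moment.\<close>
  have pow': "f ((?r ^^ n) K) \<cdot> ?P K n = ?Q (c K) n \<cdot> g K \<and> a ((?r ^^ n) K) = (?s ^^ n) (c K)"
    if "K \<in> R" "n \<le> orbit_len ?r K" for K n
  proof (cases "n < orbit_len ?r K")
    case True
    then show ?thesis using pow that(1) by blast
  next
    case False
    then have n: "n = orbit_len ?r K" using that by simp
    have l: "0 < orbit_len ?r K" using orbit_len_props(1)[OF p] .
    note Ko = transversal_subset[OF that(1)]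
    have "f K \<cdot> gid C K = gid C (c K) \<cdot> g K" and aK: "a K = c K"
      using pow[OF that(1) l] by simp_all
    then have "f K = g K"
      using comp_gid[OF fHom[OF Ko]] gid_comp[OF gK(1)[OF that(1)]] by simp
    then show ?thesis
      using gK(2,3)[OF that(1)] aK orbit_len_props(2)[OF p, of K] orbit_len_props(2)[OF q, of "c K"]
      by (simp add: n lam_def)
  qed
  \<comment> \<open>The equation is checked after composing with the morphism \<open>?P K n\<close>
    from the representative to \<open>L\<close>. It then compares the formulas for \<open>n\<close>
    and \<open>Suc n\<close>, and the latter may be the full orbit length.\<close>
  have step: "a (?r L) = ?s (a L) \<and> f (?r L) \<cdot> fst \<rho> L = fst \<sigma> (a L) \<cdot> f L" if L: "L \<in> Obj C" for L
  proof -
    obtain K n where K: "K \<in> R" "n < orbit_len ?r K" "(?r ^^ n) K = L"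
      using transversal_reach[OF L] .
    have Sn: "(?r ^^ Suc n) K = ?r L" using K by simp
    note 1 = pow[OF K(1,2), unfolded K(3)]
    have 2: "f (?r L) \<cdot> ?P K (Suc n) = ?Q (c K) (Suc n) \<cdot> g K \<and> a (?r L) = (?s ^^ Suc n) (c K)"
      using pow'[OF K(1), of "Suc n"] K(2) unfolding Sn by simp
    have aL: "a L \<in> Obj C" using HomD(5)[OF fHom[OF L]] .
    have P: "?P K n \<in> Hom C K L" using PHom[OF K(1), of n] K(3) by simp
    have Q: "?Q (c K) n \<in> Hom C (c K) (a L)" using lam_iter_Hom[OF \<sigma> co[OF K(1)], of n] 1(2) by simp
    note \<rho>L = wrD(2)[OF \<rho> L] and \<sigma>L = wrD(2)[OF \<sigma> aL] and frL = fHom[OF wrD(3)[OF \<rho> L]]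
    have "(f (?r L) \<cdot> fst \<rho> L) \<cdot> ?P K n = f (?r L) \<cdot> ?P K (Suc n)"
      using comp_assoc[OF P \<rho>L frL] K(3) by simp
    also have "\<dots> = (fst \<sigma> (a L) \<cdot> ?Q (c K) n) \<cdot> g K" using 2 1(2) by simp
    also have "\<dots> = fst \<sigma> (a L) \<cdot> (f L \<cdot> ?P K n)"
      using comp_assoc[OF gK(1)[OF K(1)] Q \<sigma>L] 1(1) by simp
    also have "\<dots> = (fst \<sigma> (a L) \<cdot> f L) \<cdot> ?P K n" using comp_assoc[OF P fHom[OF L] \<sigma>L] by simp
    finally have "f (?r L) \<cdot> fst \<rho> L = fst \<sigma> (a L) \<cdot> f L"
      by (rule comp_right_cancel[OF P comp_Hom[OF \<rho>L frL] comp_Hom[OF fHom[OF L] \<sigma>L]])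
    then show ?thesis using 2 1(2) by simp
  qed
  \<comment> \<open>Points from different orbits are separated by \<open>inj\<close>, points of one
    orbit by the equality of the lengths of \<open>K\<close> and \<open>c K\<close>.\<close>
  have a_inj: "inj_on a (Obj C)"
  proof (rule inj_onI)
    fix L M assume LM: "L \<in> Obj C" "M \<in> Obj C" "a L = a M"
    obtain K n where K: "K \<in> R" "n < orbit_len ?r K" "(?r ^^ n) K = L"
      using transversal_reach[OF LM(1)] .
    obtain J m where J: "J \<in> R" "m < orbit_len ?r J" "(?r ^^ m) J = M"
      using transversal_reach[OF LM(2)] .
    have eq: "(?s ^^ n) (c K) = (?s ^^ m) (c J)"
      using pow(2)[OF K(1,2)] pow(2)[OF J(1,2)] K(3) J(3) LM(3) by simp
    have "orb ?s (c K) = orb ?s ((?s ^^ n) (c K))"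
      by (rule orb_eq_of_mem[OF q, symmetric]) (auto simp: orb_def)
    also have "\<dots> = orb ?s (c J)"
      unfolding eq by (rule orb_eq_of_mem[OF q]) (auto simp: orb_def)
    finally have KJ: "K = J" using inj_onD[OF inj _ K(1) J(1)] by (simp add: c_def)
    then have "n = m"
      using inj_onD[OF inj_on_funpow_orbit[OF q, of "c K"], of n m] eq K(2) J(2) gK(2)[OF K(1)] by simp
    then show "L = M" using K J KJ by simp
  qed
  have "a ` Obj C \<subseteq> Obj C" using HomD(5)[OF fHom] by blast
  then have "bij_betw a (Obj C) (Obj C)"
    using a_inj finite_Obj by (simp add: bij_betw_def endo_inj_surj)
  then have a_perm: "a permutes Obj C" by (rule bij_imp_permutes) (simp add: a_def)
  have w: "(f, a) \<in> wr C" using a_perm fHom by (auto simp: wr_def f_def)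
  have "wr_mult C (f, a) \<rho> = wr_mult C \<sigma> (f, a)"
    using step by (intro wr_eqI[OF wr_mult_closed[OF \<rho> w] wr_mult_closed[OF w \<sigma>]]) (simp add: wr_mult_def)
  then have "(f, a) \<in> transporter \<rho> \<sigma>" using w by (simp add: transporter_def)
  moreover have "restrict (fst (f, a)) R = g"
  proof
    fix K show "restrict (fst (f, a)) R K = g K"
    proof (cases "K \<in> R")
      case True
      have "f K \<cdot> gid C K = gid C (c K) \<cdot> g K"
        using pow(1)[OF True, of 0] orbit_len_props(1)[OF p] by simp
      then show ?thesis
        using True comp_gid[OF fHom[OF transversal_subset[OF True]]] gid_comp[OF gK(1)[OF True]] by simp
    next
      case False
      then show ?thesis using PiE_arb[OF g] by simp
    qed
  qed
  ultimately show ?thesis by blast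
qed

lemma finite_transversal: "finite R"
  using R finite_Obj finite_subset by (auto simp: transversal_def)

text \<open>An infinite set has \<open>card\<close> 0, so finiteness is what turns a non-empty
  transporter into a non-zero count.\<close>

lemma finite_transporter: "finite (transporter \<rho> \<sigma>)"
proof (rule inj_on_finite[OF transporter_inj])
  show "(\<lambda>\<alpha>. restrict (fst \<alpha>) R) ` transporter \<rho> \<sigma> \<subseteq> PiE R (branches \<rho> \<sigma>)"
    using transporter_restrict by blast
  show "finite (PiE R (branches \<rho> \<sigma>))"
    using finite_transversal finite_branches by (rule finite_PiE)
qed

text \<open>Restriction to \<open>R\<close> is a bijection onto the candidate families whose members
  reach distinct \<sigma>-orbits. The formula covers an empty transporter too: truncated subtraction
  yields a factor 0 when \<rho> has more orbits of some type than \<sigma>.\<close>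

lemma card_transporter_transversal:
  "card (transporter \<rho> \<sigma>) = (\<Prod>u\<in>{1..card (Obj C)} \<times> digamma C.
     (\<Prod>i<card (orbits \<rho> u). card (orbits \<sigma> u) - i) * (fst u * cent_card C (snd u)) ^ card (orbits \<rho> u))"
proof -
  let ?T = "{1..card (Obj C)} \<times> digamma C"
  let ?G = "{g \<in> PiE R (branches \<rho> \<sigma>). inj_on (\<lambda>K. orb (snd \<sigma>) (gcod C (g K))) R}"
  have "bij_betw (\<lambda>\<alpha>. restrict (fst \<alpha>) R) (transporter \<rho> \<sigma>) ?G"
    unfolding bij_betw_def
  proof (intro conjI transporter_inj equalityI image_subsetI subsetI)
    fix \<alpha> assume "\<alpha> \<in> transporter \<rho> \<sigma>"
    then show "restrict (fst \<alpha>) R \<in> ?G" by (rule transporter_restrict)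
  next
    fix g assume "g \<in> ?G"
    then have "\<exists>\<alpha>\<in>transporter \<rho> \<sigma>. restrict (fst \<alpha>) R = g" by (intro transporter_extend) simp_all
    then show "g \<in> (\<lambda>\<alpha>. restrict (fst \<alpha>) R) ` transporter \<rho> \<sigma>" by blast
  qed
  then have "card (transporter \<rho> \<sigma>) = card ?G" by (rule bij_betw_same_card)
  \<comment> \<open>In \<open>card_injective_choices\<close> the class of a candidate is the
    \<sigma>-orbit of its codomain, \<open>S u\<close> is \<open>orbits \<sigma> u\<close>, and the
    weight is the fibre size from \<open>card_branches_fibre\<close>.\<close>
  also have "\<dots> = (\<Prod>u\<in>?T. (\<Prod>i<card {K \<in> R. orbit_type \<rho> K = u}. card (orbits \<sigma> u) - i) *
      (fst u * cent_card C (snd u)) ^ card {K \<in> R. orbit_type \<rho> K = u})"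
  proof (rule card_injective_choices)
    show "finite R" by (rule finite_transversal)
    have "finite (aut C)" using finite_Mor by (simp add: aut_def)
    then show "finite ?T" by (simp add: digamma_def)
    show "orbit_type \<rho> ` R \<subseteq> ?T" using orbit_type_range[OF \<rho> transversal_subset] by blast
    show "orb (snd \<sigma>) (gcod C f) \<in> orbits \<sigma> (orbit_type \<rho> K)" if "K \<in> R" "f \<in> branches \<rho> \<sigma> K" for K f
      using that branches_iff[OF \<rho> \<sigma> transversal_subset[OF that(1)], of f]
      by (simp add: orb_mem_orbits_iff[OF \<sigma>])
  qed (use finite_branches finite_orbits orbits_disjoint[OF \<sigma>]
      card_branches_fibre[OF \<rho> \<sigma> transversal_subset] in auto)
  \<comment> \<open>\<open>R\<close> meets every \<rho>-orbit exactly once, so its members of type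
    \<open>u\<close> are as many as the orbits of type \<open>u\<close>.\<close>
  also have "\<dots> = (\<Prod>u\<in>?T. (\<Prod>i<card (orbits \<rho> u). card (orbits \<sigma> u) - i) *
      (fst u * cent_card C (snd u)) ^ card (orbits \<rho> u))"
  proof (rule prod.cong)
    fix u
    have "orbits \<rho> u = orb (snd \<rho>) ` {K \<in> R. orbit_type \<rho> K = u}"
    proof (intro equalityI subsetI)
      fix B assume B: "B \<in> orbits \<rho> u"
      then have "B \<in> orb (snd \<rho>) ` Obj C" by (auto simp: orbits_def)
      then have "B \<in> orb (snd \<rho>) ` R" using R by (simp add: transversal_def)
      then obtain K where K: "K \<in> R" "B = orb (snd \<rho>) K" by blast
      then show "B \<in> orb (snd \<rho>) ` {K \<in> R. orbit_type \<rho> K = u}"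
        using B orb_mem_orbits_iff[OF \<rho> transversal_subset[OF K(1)]] by blast
    qed (auto simp: orbits_def dest: transversal_subset)
    moreover have "inj_on (orb (snd \<rho>)) {K \<in> R. orbit_type \<rho> K = u}"
      using transversal_inj by (auto intro: inj_onI)
    ultimately have "card {K \<in> R. orbit_type \<rho> K = u} = card (orbits \<rho> u)" by (simp add: card_image)
    then show "(\<Prod>i<card {K \<in> R. orbit_type \<rho> K = u}. card (orbits \<sigma> u) - i) *
        (fst u * cent_card C (snd u)) ^ card {K \<in> R. orbit_type \<rho> K = u} =
      (\<Prod>i<card (orbits \<rho> u). card (orbits \<sigma> u) - i) *
        (fst u * cent_card C (snd u)) ^ card (orbits \<rho> u)"
      by simp
  qed simp
  finally show ?thesis .
qed

text \<open>Restriction to \<open>R\<close> embeds \<open>A\<close> into the product of the sets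
  \<open>S K\<close> over \<open>R\<close>, with one factor per orbit. \<open>A\<close> and
  \<open>S\<close> are left general so that they can come from a subgroupoid.\<close>

lemma card_le_power_num_orbits:
  assumes sub: "\<And>\<alpha>. \<alpha> \<in> A \<Longrightarrow> \<alpha> \<in> transporter \<rho> \<sigma>"
    and star: "\<And>\<alpha> K. \<alpha> \<in> A \<Longrightarrow> K \<in> Obj C \<Longrightarrow> fst \<alpha> K \<in> S K"
    and fin: "\<And>K. K \<in> Obj C \<Longrightarrow> finite (S K)" and le: "\<And>K. K \<in> Obj C \<Longrightarrow> card (S K) \<le> m"
  shows "card A \<le> m ^ num_orbits C (snd \<rho>)"
proof -
  have "card A \<le> card (PiE R S)"
  proof (rule card_inj_on_le)
    show "inj_on (\<lambda>\<alpha>. restrict (fst \<alpha>) R) A"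
      using sub by (intro inj_on_subset[OF transporter_inj]) blast
    show "(\<lambda>\<alpha>. restrict (fst \<alpha>) R) ` A \<subseteq> PiE R S"
      using star transversal_subset by auto
    show "finite (PiE R S)"
      using finite_transversal fin[OF transversal_subset] by (rule finite_PiE)
  qed
  also have "\<dots> = (\<Prod>K\<in>R. card (S K))" by (rule card_PiE[OF finite_transversal])
  also have "\<dots> \<le> (\<Prod>K\<in>R. m)" using le transversal_subset by (intro prod_mono) auto
  also have "\<dots> = m ^ card (orb (snd \<rho>) ` R)"
    using R card_image[of "orb (snd \<rho>)" R] by (simp only: transversal_def prod_constant)
  also have "orb (snd \<rho>) ` R = {orb (snd \<rho>) K | K. K \<in> Obj C}"
    using R unfolding transversal_def by blast
  finally show ?thesis by (simp add: num_orbits_def)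
qed

end

section \<open>Cycle counts and the conjugacy criterion\<close>

lemma card_transporter:
  assumes "\<rho> \<in> wr C" "\<sigma> \<in> wr C"
  shows "card (transporter \<rho> \<sigma>) = (\<Prod>k\<in>{1..card (Obj C)}. \<Prod>X\<in>digamma C.
     (\<Prod>i<cyc C \<rho> k X. cyc C \<sigma> k X - i) * (k * cent_card C X) ^ cyc C \<rho> k X)"
proof -
  obtain R where "transversal (snd \<rho>) R" using ex_transversal by blast
  from card_transporter_transversal[OF assms this] show ?thesis
    by (simp add: prod.cartesian_product case_prod_beta cyc_eq_card_orbits)
qed

lemma finite_digamma: "finite (digamma C)"
  using finite_Mor by (simp add: digamma_def aut_def)

lemma cyc_eq_0:
  assumes "\<rho> \<in> wr C" "k \<notin> {1..card (Obj C)}"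
  shows "cyc C \<rho> k X = 0"
proof -
  have "orbits \<rho> (k, X) = {}"
    using orbit_type_range[OF assms(1)] assms(2) by (force simp: orbits_def)
  then show ?thesis by (simp add: cyc_eq_card_orbits)
qed

lemma cyc_le_if_transporter:
  assumes "\<rho> \<in> wr C" "\<sigma> \<in> wr C" "transporter \<rho> \<sigma> \<noteq> {}" "X \<in> digamma C"
  shows "cyc C \<rho> k X \<le> cyc C \<sigma> k X"
proof (cases "k \<in> {1..card (Obj C)}")
  case True
  obtain R where "transversal (snd \<rho>) R" using ex_transversal by blast
  then have "card (transporter \<rho> \<sigma>) \<noteq> 0"
    using finite_transporter[OF assms(1,2)] assms(3) by simp
  then have "(\<Prod>i<cyc C \<rho> k X. cyc C \<sigma> k X - i) \<noteq> 0"
    using True assms(4) finite_digamma unfolding card_transporter[OF assms(1,2)] by simp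
  \<comment> \<open>If \<rho> had the larger count, the product would contain the index
    \<open>cyc C \<sigma> k X\<close>, whose factor is 0.\<close>
  then have "\<not> cyc C \<sigma> k X < cyc C \<rho> k X" by auto
  then show ?thesis by simp
qed (simp add: cyc_eq_0[OF assms(1)])

text \<open>For equal counts the falling product runs down to 1 and becomes a factorial.\<close>

lemma card_transporter_eq:
  assumes "\<rho> \<in> wr C" "\<sigma> \<in> wr C" "\<And>k X. k \<ge> 1 \<Longrightarrow> X \<in> digamma C \<Longrightarrow> cyc C \<rho> k X = cyc C \<sigma> k X"
  shows "card (transporter \<rho> \<sigma>) = (\<Prod>k\<in>{1..card (Obj C)}. \<Prod>X\<in>digamma C.
     fact (cyc C \<rho> k X) * (k * cent_card C X) ^ cyc C \<rho> k X)"
  unfolding card_transporter[OF assms(1,2)]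
proof (intro prod.cong refl)
  fix k X assume "k \<in> {1..card (Obj C)}" "X \<in> digamma C"
  then have "cyc C \<sigma> k X = cyc C \<rho> k X" using assms(3)[of k X] by simp
  then show "(\<Prod>i<cyc C \<rho> k X. cyc C \<sigma> k X - i) * (k * cent_card C X) ^ cyc C \<rho> k X =
      fact (cyc C \<rho> k X) * (k * cent_card C X) ^ cyc C \<rho> k X"
    using fact_prod_rev[of "cyc C \<rho> k X", where 'a = nat] by (simp add: atLeast0LessThan)
qed

text \<open>Conjugacy gives the inequality between counts in both directions. Conversely, equal
  counts make the size of the transporter a product of positive numbers, since \<open>k\<close> is
  at least 1 and centralizers are non-empty.\<close>

lemma wr_conjugate_iff_cyc:
  assumes "\<rho> \<in> wr C" "\<sigma> \<in> wr C"
  shows "wr_conjugate C \<rho> \<sigma> \<longleftrightarrow> (\<forall>k\<ge>1. \<forall>X\<in>digamma C. cyc C \<rho> k X = cyc C \<sigma> k X)"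
proof
  assume "wr_conjugate C \<rho> \<sigma>"
  then have t: "transporter \<rho> \<sigma> \<noteq> {}" by (simp add: wr_conjugate_iff[OF assms])
  show "\<forall>k\<ge>1. \<forall>X\<in>digamma C. cyc C \<rho> k X = cyc C \<sigma> k X"
    using cyc_le_if_transporter[OF assms t]
      cyc_le_if_transporter[OF assms(2,1) transporter_sym[OF assms t]] by (auto intro: antisym)
next
  assume "\<forall>k\<ge>1. \<forall>X\<in>digamma C. cyc C \<rho> k X = cyc C \<sigma> k X"
  then have "card (transporter \<rho> \<sigma>) = (\<Prod>k\<in>{1..card (Obj C)}. \<Prod>X\<in>digamma C.
     fact (cyc C \<rho> k X) * (k * cent_card C X) ^ cyc C \<rho> k X)"
    by (intro card_transporter_eq[OF assms]) auto
  also have "\<dots> > 0" by (intro prod_pos ballI) (auto dest: cent_card_pos)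
  finally show "wr_conjugate C \<rho> \<sigma>" by (auto simp: wr_conjugate_iff[OF assms])
qed

text \<open>Composing \<open>f : K \<rightarrow> L\<close> with the inverse of a fixed morphism \<open>K \<rightarrow> L\<close> injects the
  morphisms out of \<open>K\<close> into the automorphisms.\<close>

lemma card_star_le: "card {f \<in> Mor C. gdom C f = K} \<le> card (aut C)"
proof -
  define h where "h L = (SOME f. f \<in> Hom C K L)" for L
  have f: "f \<in> Hom C K (gcod C f)" if "f \<in> {f \<in> Mor C. gdom C f = K}" for f
    using that by (simp add: Hom_def)
  have h: "h (gcod C f) \<in> Hom C K (gcod C f)" if "f \<in> {f \<in> Mor C. gdom C f = K}" for f
    unfolding h_def using f[OF that] by (rule someI)
  have c: "f \<cdot> ginv (h (gcod C f)) \<in> Hom C (gcod C f) (gcod C f)" if "f \<in> {f \<in> Mor C. gdom C f = K}" for f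
    by (rule comp_Hom[OF ginv_Hom[OF h[OF that]] f[OF that]])
  show ?thesis
  proof (rule card_inj_on_le)
    show "inj_on (\<lambda>f. f \<cdot> ginv (h (gcod C f))) {f \<in> Mor C. gdom C f = K}"
    proof (rule inj_onI)
      fix f f' assume ff: "f \<in> {f \<in> Mor C. gdom C f = K}" "f' \<in> {f \<in> Mor C. gdom C f = K}"
        and eq: "f \<cdot> ginv (h (gcod C f)) = f' \<cdot> ginv (h (gcod C f'))"
      \<comment> \<open>The composite is an automorphism of \<open>gcod C f\<close>, so it
        determines this object and with it the fixed morphism to cancel.\<close>
      have "gcod C f = gcod C f'"
        using HomD(2)[OF c[OF ff(1)]] HomD(2)[OF c[OF ff(2)]] eq by simp
      then show "f = f'"
        using comp_right_cancel[OF ginv_Hom[OF h[OF ff(1)]] f[OF ff(1)] f[OF ff(2)]] eq by simp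
    qed
    show "(\<lambda>f. f \<cdot> ginv (h (gcod C f))) ` {f \<in> Mor C. gdom C f = K} \<subseteq> aut C"
      using Hom_aut[OF c] by blast
    show "finite (aut C)" using finite_Mor by (simp add: aut_def)
  qed
qed

end

theorem mainTheorem12:
  fixes C D :: "('o, 'm) groupoid" and \<rho> \<sigma> :: "('o, 'm) wr_elem"
  assumes "finite_groupoid C"
    and "\<rho> \<in> wr C" and "\<sigma> \<in> wr C"
  shows "(wr_conjugate C \<rho> \<sigma> \<longleftrightarrow>
            (\<forall>k\<ge>1. \<forall>X\<in>digamma C. cyc C \<rho> k X = cyc C \<sigma> k X)) \<and>
         ((\<forall>k\<ge>1. \<forall>X\<in>digamma C. cyc C \<rho> k X = cyc C \<sigma> k X) \<longrightarrow>
           card {\<alpha> \<in> wr C. wr_mult C \<alpha> \<rho> = wr_mult C \<sigma> \<alpha>} =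
           (\<Prod>k\<in>{1..card (Obj C)}. \<Prod>X\<in>digamma C.
               fact (cyc C \<rho> k X) * (k * cent_card C X) ^ (cyc C \<rho> k X))) \<and>
         (wide_subgroupoid D C \<longrightarrow>
           card {\<alpha> \<in> wr D. wr_mult C \<alpha> \<rho> = wr_mult C \<sigma> \<alpha>}
             \<le> card (aut D) ^ num_orbits C (snd \<rho>))"
proof (intro conjI impI)
  interpret fin_groupoid C using assms(1) by (rule fin_groupoid.intro)
  show "wr_conjugate C \<rho> \<sigma> \<longleftrightarrow> (\<forall>k\<ge>1. \<forall>X\<in>digamma C. cyc C \<rho> k X = cyc C \<sigma> k X)"
    by (rule wr_conjugate_iff_cyc[OF assms(2,3)])
  show "card {\<alpha> \<in> wr C. wr_mult C \<alpha> \<rho> = wr_mult C \<sigma> \<alpha>} =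
      (\<Prod>k\<in>{1..card (Obj C)}. \<Prod>X\<in>digamma C.
         fact (cyc C \<rho> k X) * (k * cent_card C X) ^ (cyc C \<rho> k X))"
    if "\<forall>k\<ge>1. \<forall>X\<in>digamma C. cyc C \<rho> k X = cyc C \<sigma> k X"
    using card_transporter_eq[OF assms(2,3)] that by (simp add: transporter_def)
  assume D: "wide_subgroupoid D C"
  then have "finite_groupoid D"
    using finite_Obj finite_Mor finite_subset by (auto simp: wide_subgroupoid_def finite_groupoid_def)
  then interpret D: fin_groupoid D by (rule fin_groupoid.intro)
  have Obj: "Obj D = Obj C" and Hom: "Hom D K L \<subseteq> Hom C K L" for K L
    using D by (auto simp: wide_subgroupoid_def Hom_def)
  have sub: "wr D \<subseteq> wr C" using Hom by (auto simp: wr_def Obj)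
  obtain R where R: "transversal (snd \<rho>) R" using ex_transversal by blast
  \<comment> \<open>\<rho> and \<sigma> are given in \<open>wr C\<close>, so determination by
    representatives is taken from \<open>C\<close>. The components of \<alpha> at \<open>K\<close>
    lie among the morphisms of \<open>D\<close> out of \<open>K\<close>, and their number is bounded
    by \<open>card_star_le\<close> applied to \<open>D\<close>.\<close>
  show "card {\<alpha> \<in> wr D. wr_mult C \<alpha> \<rho> = wr_mult C \<sigma> \<alpha>} \<le> card (aut D) ^ num_orbits C (snd \<rho>)"
  proof (rule card_le_power_num_orbits[OF assms(2,3) R])
    show "fst \<alpha> K \<in> {f \<in> Mor D. gdom D f = K}"
      if "\<alpha> \<in> {\<alpha> \<in> wr D. wr_mult C \<alpha> \<rho> = wr_mult C \<sigma> \<alpha>}" "K \<in> Obj C" for \<alpha> K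
      using that D.wrD(2)[of \<alpha> K] by (simp add: Obj Hom_def)
  qed (use sub D.finite_Mor D.card_star_le in \<open>auto simp: transporter_def\<close>)
qed

end
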